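(* If the variety $\Theta$ is logically perfect, then it is logically regular.
   Context: Fix a variety $\Theta$, an infinite set of variables $X^0$, and let $\Gamma$ be the set of finite subsets of $X^0$; $W(X)$ is the free algebra of $\Theta$ over $X$. For $H\in\Theta$, $\mathrm{Hal}^X_\Theta(H)$ is the Boolean algebra of subsets of $\mathrm{Hom}(W(X),H)$ with quantifiers ($\mu\in\exists xA$ iff some $\nu\in A$ agrees with $\mu$ off $x$), equalities $[w\equiv w']_H=\{\mu:\mu(w)=\mu(w')\}$ and maps $s_*(A)=\{\mu:\mu\circ s\in A\}$ for homomorphisms $s:W(X)\to W(Y)$. The multi-sorted algebra of formulas $\Phi=(\Phi(X),X\in\Gamma)$ is the free Halmos algebra (multi-sorted algebras with sorts extended Boolean algebras with quantifiers $\exists x$, equalities $w\equiv w'$, and operations $s_*$, satisfying the Halmos axioms) over the sets of formal equalities $w\equiv w'$, $w,w'\in W(X)$; $\mathrm{Val}^X_H:\Phi(X)\to\mathrm{Hal}^X_\Theta(H)$ are the components of the unique homomorphism sending $w\equiv w'$ to $[w\equiv w']_H$. A point $\mu:W(X)\to H$ satisfies $u$ iff $\mu\in\mathrm{Val}^X_H(u)$; $\mathrm{LKer}(\mu)$ is the set of formulas satisfied by $\mu$. For $T\subseteq\Phi(X)$, $T^L_H=\{\mu:T\subseteq\mathrm{LKer}(\mu)\}$, for $A\subseteq\mathrm{Hom}(W(X),H)$, $A^L_H=\bigcap_{\mu\in A}\mathrm{LKer}(\mu)$, $T^{LL}_H=(T^L_H)^L_H$; $H_1,H_2$ are LG-equivalent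 iff $T^{LL}_{H_1}=T^{LL}_{H_2}$ for all $X\in\Gamma$, $T\subseteq\Phi(X)$. An algebra $H\in\Theta$ is logically homogeneous if for any two points $\mu,\nu:W(X)\to H$ ($X\in\Gamma$), $\mathrm{LKer}(\mu)=\mathrm{LKer}(\nu)$ holds if and only if $\mu=\sigma\circ\nu$ for some automorphism $\sigma$ of $H$. $\Theta$ is logically perfect if every $W(X)$, $X\in\Gamma$, is logically homogeneous. $H$ is logically separable if every $H'\in\Theta$ that is LG-equivalent to $H$ is isomorphic to $H$. $\Theta$ is logically regular if every $W(X)$, $X\in\Gamma$, is logically separable. *)

theory Defs
  imports "HOL-Library.FuncSet"
begin

section \<open>Universal algebra\<close>

datatype ('f, 'x) trm = Var 'x | App 'f "('f, 'x) trm list"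

text \<open>Identities are written in the countable set of variables \<^typ>\<open>nat\<close>, independently of the
  set of variables \<open>X0\<close> used for formulas.\<close>

record 'f variety =
  arity :: "'f \<Rightarrow> nat"
  idents :: "(('f, nat) trm \<times> ('f, nat) trm) set"

record ('f, 'a) algebra =
  univ :: "'a set"
  ops :: "'f \<Rightarrow> 'a list \<Rightarrow> 'a"

inductive_set terms :: "'f variety \<Rightarrow> 'x set \<Rightarrow> ('f, 'x) trm set"
  for \<Theta> :: "'f variety" and X :: "'x set" where
  terms_Var: "x \<in> X \<Longrightarrow> Var x \<in> terms \<Theta> X"
| terms_App: "length ts = arity \<Theta> f \<Longrightarrow> \<forall>t\<in>set ts. t \<in> terms \<Theta> X \<Longrightarrow> App f ts \<in> terms \<Theta> X"

primrec tval :: "('f, 'a) algebra \<Rightarrow> ('x \<Rightarrow> 'a) \<Rightarrow> ('f, 'x) trm \<Rightarrow> 'a" where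
  "tval A v (Var x) = v x"
| "tval A v (App f ts) = ops A f (map (tval A v) ts)"

definition is_variety :: "'f variety \<Rightarrow> bool" where
  "is_variety \<Theta> \<longleftrightarrow> (\<forall>(l, r)\<in>idents \<Theta>. l \<in> terms \<Theta> UNIV \<and> r \<in> terms \<Theta> UNIV)"

text \<open>The empty algebra is admitted (it occurs only in signatures without constants), so that
  the free algebra over the empty set of variables always exists.\<close>

definition in_variety :: "'f variety \<Rightarrow> ('f, 'a) algebra \<Rightarrow> bool" where
  "in_variety \<Theta> A \<longleftrightarrow>
    (\<forall>f as. length as = arity \<Theta> f \<and> set as \<subseteq> univ A \<longrightarrow> ops A f as \<in> univ A) \<and>
    (\<forall>(l, r)\<in>idents \<Theta>. \<forall>v. range v \<subseteq> univ A \<longrightarrow> tval A v l = tval A v r)"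

definition Hom :: "'f variety \<Rightarrow> ('f, 'a) algebra \<Rightarrow> ('f, 'b) algebra \<Rightarrow> ('a \<Rightarrow> 'b) set" where
  "Hom \<Theta> A B = {h \<in> univ A \<rightarrow>\<^sub>E univ B.
    \<forall>f as. length as = arity \<Theta> f \<and> set as \<subseteq> univ A \<longrightarrow> h (ops A f as) = ops B f (map h as)}"

definition isomorphic :: "'f variety \<Rightarrow> ('f, 'a) algebra \<Rightarrow> ('f, 'b) algebra \<Rightarrow> bool" where
  "isomorphic \<Theta> A B \<longleftrightarrow> (\<exists>h\<in>Hom \<Theta> A B. bij_betw h (univ A) (univ B))"

definition Aut :: "'f variety \<Rightarrow> ('f, 'a) algebra \<Rightarrow> ('a \<Rightarrow> 'a) set" where
  "Aut \<Theta> A = {h \<in> Hom \<Theta> A A. bij_betw h (univ A) (univ A)}"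

definition subst :: "('y \<Rightarrow> ('f, 'x) trm) \<Rightarrow> ('f, 'y) trm \<Rightarrow> ('f, 'x) trm" where
  "subst = tval \<lparr>univ = UNIV, ops = App\<rparr>"

inductive_set term_cong :: "'f variety \<Rightarrow> 'x set \<Rightarrow> (('f, 'x) trm \<times> ('f, 'x) trm) set"
  for \<Theta> :: "'f variety" and X :: "'x set" where
  cong_refl: "t \<in> terms \<Theta> X \<Longrightarrow> (t, t) \<in> term_cong \<Theta> X"
| cong_sym: "(t, u) \<in> term_cong \<Theta> X \<Longrightarrow> (u, t) \<in> term_cong \<Theta> X"
| cong_trans: "(t, u) \<in> term_cong \<Theta> X \<Longrightarrow> (u, v) \<in> term_cong \<Theta> X \<Longrightarrow> (t, v) \<in> term_cong \<Theta> X"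
| cong_App: "length ts = arity \<Theta> f \<Longrightarrow> list_all2 (\<lambda>t u. (t, u) \<in> term_cong \<Theta> X) ts us \<Longrightarrow>
    (App f ts, App f us) \<in> term_cong \<Theta> X"
| cong_ident: "(l, r) \<in> idents \<Theta> \<Longrightarrow> range \<sigma> \<subseteq> terms \<Theta> X \<Longrightarrow>
    (subst \<sigma> l, subst \<sigma> r) \<in> term_cong \<Theta> X"

type_synonym ('f, 'x) word = "('f, 'x) trm set"

definition W :: "'f variety \<Rightarrow> 'x set \<Rightarrow> ('f, ('f, 'x) word) algebra" where
  "W \<Theta> X = \<lparr>univ = terms \<Theta> X // term_cong \<Theta> X,
    ops = (\<lambda>f as. \<Union>ts\<in>listset as. term_cong \<Theta> X `` {App f ts})\<rparr>"

definition gen :: "'f variety \<Rightarrow> 'x set \<Rightarrow> 'x \<Rightarrow> ('f, 'x) word" where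
  "gen \<Theta> X x = term_cong \<Theta> X `` {Var x}"

text \<open>\<open>y\<close> lies outside the support of an element of \<open>W(Y)\<close> iff the element can be written
  without \<open>y\<close>.\<close>

definition avoids :: "'f variety \<Rightarrow> 'x set \<Rightarrow> 'x \<Rightarrow> ('f, 'x) word \<Rightarrow> bool" where
  "avoids \<Theta> Y y w \<longleftrightarrow> (\<exists>t\<in>w. t \<in> terms \<Theta> (Y - {y}))"

section \<open>Halmos algebras\<close>

definition Sorts :: "'x set \<Rightarrow> 'x set set" where
  "Sorts X0 = {X. finite X \<and> X \<subseteq> X0}"

text \<open>A structure in the many-sorted signature of Halmos algebras. The operation \<open>hsub L X Y s\<close>
  is \<open>s\<^sub>*\<close> for a homomorphism \<open>s\<close> from \<open>W(X)\<close> to \<open>W(Y)\<close>; the equalities \<open>heq L X w w'\<close> are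
  constants.\<close>

record ('f, 'x, 'l) hal =
  hcar :: "'x set \<Rightarrow> 'l set"
  hmeet :: "'x set \<Rightarrow> 'l \<Rightarrow> 'l \<Rightarrow> 'l"
  hjoin :: "'x set \<Rightarrow> 'l \<Rightarrow> 'l \<Rightarrow> 'l"
  hneg :: "'x set \<Rightarrow> 'l \<Rightarrow> 'l"
  hzero :: "'x set \<Rightarrow> 'l"
  hone :: "'x set \<Rightarrow> 'l"
  hex :: "'x set \<Rightarrow> 'x \<Rightarrow> 'l \<Rightarrow> 'l"
  heq :: "'x set \<Rightarrow> ('f, 'x) word \<Rightarrow> ('f, 'x) word \<Rightarrow> 'l"
  hsub :: "'x set \<Rightarrow> 'x set \<Rightarrow> (('f, 'x) word \<Rightarrow> ('f, 'x) word) \<Rightarrow> 'l \<Rightarrow> 'l"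

definition hle :: "('f, 'x, 'l) hal \<Rightarrow> 'x set \<Rightarrow> 'l \<Rightarrow> 'l \<Rightarrow> bool" where
  "hle L X a b \<longleftrightarrow> hmeet L X a b = a"

locale hal_structure =
  fixes \<Theta> :: "'f variety" and X0 :: "'x set" and L :: "('f, 'x, 'l) hal"
  assumes meet_closed:
      "\<lbrakk>X \<in> Sorts X0; a \<in> hcar L X; b \<in> hcar L X\<rbrakk> \<Longrightarrow> hmeet L X a b \<in> hcar L X"
    and join_closed:
      "\<lbrakk>X \<in> Sorts X0; a \<in> hcar L X; b \<in> hcar L X\<rbrakk> \<Longrightarrow> hjoin L X a b \<in> hcar L X"
    and neg_closed: "\<lbrakk>X \<in> Sorts X0; a \<in> hcar L X\<rbrakk> \<Longrightarrow> hneg L X a \<in> hcar L X"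
    and zero_closed: "X \<in> Sorts X0 \<Longrightarrow> hzero L X \<in> hcar L X"
    and one_closed: "X \<in> Sorts X0 \<Longrightarrow> hone L X \<in> hcar L X"
    and ex_closed: "\<lbrakk>X \<in> Sorts X0; x \<in> X; a \<in> hcar L X\<rbrakk> \<Longrightarrow> hex L X x a \<in> hcar L X"
    and eq_closed:
      "\<lbrakk>X \<in> Sorts X0; w \<in> univ (W \<Theta> X); w' \<in> univ (W \<Theta> X)\<rbrakk> \<Longrightarrow> heq L X w w' \<in> hcar L X"
    and sub_closed:
      "\<lbrakk>X \<in> Sorts X0; Y \<in> Sorts X0; s \<in> Hom \<Theta> (W \<Theta> X) (W \<Theta> Y); a \<in> hcar L X\<rbrakk>
        \<Longrightarrow> hsub L X Y s a \<in> hcar L Y"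

text \<open>The Boolean axioms are Huntington's; \<open>0 = 1\<close> is not excluded.\<close>

locale halmos_algebra = hal_structure +
  assumes meet_comm:
      "\<lbrakk>X \<in> Sorts X0; a \<in> hcar L X; b \<in> hcar L X\<rbrakk> \<Longrightarrow> hmeet L X a b = hmeet L X b a"
    and join_comm:
      "\<lbrakk>X \<in> Sorts X0; a \<in> hcar L X; b \<in> hcar L X\<rbrakk> \<Longrightarrow> hjoin L X a b = hjoin L X b a"
    and meet_join_distrib:
      "\<lbrakk>X \<in> Sorts X0; a \<in> hcar L X; b \<in> hcar L X; c \<in> hcar L X\<rbrakk>
        \<Longrightarrow> hmeet L X a (hjoin L X b c) = hjoin L X (hmeet L X a b) (hmeet L X a c)"
    and join_meet_distrib:
      "\<lbrakk>X \<in> Sorts X0; a \<in> hcar L X; b \<in> hcar L X; c \<in> hcar L X\<rbrakk>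
        \<Longrightarrow> hjoin L X a (hmeet L X b c) = hmeet L X (hjoin L X a b) (hjoin L X a c)"
    and meet_one: "\<lbrakk>X \<in> Sorts X0; a \<in> hcar L X\<rbrakk> \<Longrightarrow> hmeet L X a (hone L X) = a"
    and join_zero: "\<lbrakk>X \<in> Sorts X0; a \<in> hcar L X\<rbrakk> \<Longrightarrow> hjoin L X a (hzero L X) = a"
    and meet_neg: "\<lbrakk>X \<in> Sorts X0; a \<in> hcar L X\<rbrakk> \<Longrightarrow> hmeet L X a (hneg L X a) = hzero L X"
    and join_neg: "\<lbrakk>X \<in> Sorts X0; a \<in> hcar L X\<rbrakk> \<Longrightarrow> hjoin L X a (hneg L X a) = hone L X"
    \<comment> \<open>quantifiers\<close>
    and ex_zero: "\<lbrakk>X \<in> Sorts X0; x \<in> X\<rbrakk> \<Longrightarrow> hex L X x (hzero L X) = hzero L X"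
    and ex_ge: "\<lbrakk>X \<in> Sorts X0; x \<in> X; a \<in> hcar L X\<rbrakk> \<Longrightarrow> hle L X a (hex L X x a)"
    and ex_meet:
      "\<lbrakk>X \<in> Sorts X0; x \<in> X; a \<in> hcar L X; b \<in> hcar L X\<rbrakk>
        \<Longrightarrow> hex L X x (hmeet L X a (hex L X x b)) = hmeet L X (hex L X x a) (hex L X x b)"
    and ex_comm:
      "\<lbrakk>X \<in> Sorts X0; x \<in> X; y \<in> X; a \<in> hcar L X\<rbrakk>
        \<Longrightarrow> hex L X x (hex L X y a) = hex L X y (hex L X x a)"
    \<comment> \<open>equalities\<close>
    and eq_refl: "\<lbrakk>X \<in> Sorts X0; w \<in> univ (W \<Theta> X)\<rbrakk> \<Longrightarrow> heq L X w w = hone L X"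
    and eq_ops:
      "\<lbrakk>X \<in> Sorts X0; length ws = arity \<Theta> f; length ws' = arity \<Theta> f;
        set ws \<subseteq> univ (W \<Theta> X); set ws' \<subseteq> univ (W \<Theta> X)\<rbrakk>
        \<Longrightarrow> hle L X (foldr (hmeet L X) (map2 (heq L X) ws ws') (hone L X))
              (heq L X (ops (W \<Theta> X) f ws) (ops (W \<Theta> X) f ws'))"
    \<comment> \<open>\<open>s \<mapsto> s\<^sub>*\<close> is a functor into Boolean algebras\<close>
    and sub_meet:
      "\<lbrakk>X \<in> Sorts X0; Y \<in> Sorts X0; s \<in> Hom \<Theta> (W \<Theta> X) (W \<Theta> Y); a \<in> hcar L X; b \<in> hcar L X\<rbrakk>
        \<Longrightarrow> hsub L X Y s (hmeet L X a b) = hmeet L Y (hsub L X Y s a) (hsub L X Y s b)"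
    and sub_join:
      "\<lbrakk>X \<in> Sorts X0; Y \<in> Sorts X0; s \<in> Hom \<Theta> (W \<Theta> X) (W \<Theta> Y); a \<in> hcar L X; b \<in> hcar L X\<rbrakk>
        \<Longrightarrow> hsub L X Y s (hjoin L X a b) = hjoin L Y (hsub L X Y s a) (hsub L X Y s b)"
    and sub_neg:
      "\<lbrakk>X \<in> Sorts X0; Y \<in> Sorts X0; s \<in> Hom \<Theta> (W \<Theta> X) (W \<Theta> Y); a \<in> hcar L X\<rbrakk>
        \<Longrightarrow> hsub L X Y s (hneg L X a) = hneg L Y (hsub L X Y s a)"
    and sub_zero:
      "\<lbrakk>X \<in> Sorts X0; Y \<in> Sorts X0; s \<in> Hom \<Theta> (W \<Theta> X) (W \<Theta> Y)\<rbrakk>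
        \<Longrightarrow> hsub L X Y s (hzero L X) = hzero L Y"
    and sub_one:
      "\<lbrakk>X \<in> Sorts X0; Y \<in> Sorts X0; s \<in> Hom \<Theta> (W \<Theta> X) (W \<Theta> Y)\<rbrakk>
        \<Longrightarrow> hsub L X Y s (hone L X) = hone L Y"
    and sub_id:
      "\<lbrakk>X \<in> Sorts X0; a \<in> hcar L X\<rbrakk> \<Longrightarrow> hsub L X X (restrict id (univ (W \<Theta> X))) a = a"
    and sub_comp:
      "\<lbrakk>X \<in> Sorts X0; Y \<in> Sorts X0; Z \<in> Sorts X0; s \<in> Hom \<Theta> (W \<Theta> X) (W \<Theta> Y);
        s' \<in> Hom \<Theta> (W \<Theta> Y) (W \<Theta> Z); a \<in> hcar L X\<rbrakk>
        \<Longrightarrow> hsub L Y Z s' (hsub L X Y s a) = hsub L X Z (compose (univ (W \<Theta> X)) s' s) a"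
    \<comment> \<open>\<open>s\<^sub>*\<close> and quantifiers\<close>
    and sub_ex_eq:
      "\<lbrakk>X \<in> Sorts X0; Y \<in> Sorts X0; s \<in> Hom \<Theta> (W \<Theta> X) (W \<Theta> Y); s' \<in> Hom \<Theta> (W \<Theta> X) (W \<Theta> Y);
        x \<in> X; a \<in> hcar L X; \<And>y. y \<in> X - {x} \<Longrightarrow> s (gen \<Theta> X y) = s' (gen \<Theta> X y)\<rbrakk>
        \<Longrightarrow> hsub L X Y s (hex L X x a) = hsub L X Y s' (hex L X x a)"
    and sub_ex:
      "\<lbrakk>X \<in> Sorts X0; Y \<in> Sorts X0; s \<in> Hom \<Theta> (W \<Theta> X) (W \<Theta> Y); x \<in> X; y \<in> Y; a \<in> hcar L X;
        s (gen \<Theta> X x) = gen \<Theta> Y y;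
        \<And>x'. x' \<in> X - {x} \<Longrightarrow> avoids \<Theta> Y y (s (gen \<Theta> X x'))\<rbrakk>
        \<Longrightarrow> hsub L X Y s (hex L X x a) = hex L Y y (hsub L X Y s a)"
    \<comment> \<open>\<open>s\<^sub>*\<close> and equalities\<close>
    and sub_eq:
      "\<lbrakk>X \<in> Sorts X0; Y \<in> Sorts X0; s \<in> Hom \<Theta> (W \<Theta> X) (W \<Theta> Y); w \<in> univ (W \<Theta> X);
        w' \<in> univ (W \<Theta> X)\<rbrakk> \<Longrightarrow> hsub L X Y s (heq L X w w') = heq L Y (s w) (s w')"
    and eq_sub:
      "\<lbrakk>X \<in> Sorts X0; x \<in> X; s \<in> Hom \<Theta> (W \<Theta> X) (W \<Theta> X); s' \<in> Hom \<Theta> (W \<Theta> X) (W \<Theta> X);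
        a \<in> hcar L X; \<And>y. y \<in> X - {x} \<Longrightarrow> s (gen \<Theta> X y) = gen \<Theta> X y;
        \<And>y. y \<in> X - {x} \<Longrightarrow> s' (gen \<Theta> X y) = gen \<Theta> X y\<rbrakk>
        \<Longrightarrow> hle L X (hmeet L X (hsub L X X s a) (heq L X (s (gen \<Theta> X x)) (s' (gen \<Theta> X x))))
              (hsub L X X s' a)"

definition hal_hom ::
  "'f variety \<Rightarrow> 'x set \<Rightarrow> ('f, 'x, 'l) hal \<Rightarrow> ('f, 'x, 'm) hal \<Rightarrow> ('x set \<Rightarrow> 'l \<Rightarrow> 'm) set" where
  "hal_hom \<Theta> X0 L M = {\<phi> \<in> (\<Pi>\<^sub>E X\<in>Sorts X0. hcar L X \<rightarrow>\<^sub>E hcar M X).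
    \<forall>X\<in>Sorts X0.
      (\<forall>a\<in>hcar L X. \<forall>b\<in>hcar L X. \<phi> X (hmeet L X a b) = hmeet M X (\<phi> X a) (\<phi> X b)) \<and>
      (\<forall>a\<in>hcar L X. \<forall>b\<in>hcar L X. \<phi> X (hjoin L X a b) = hjoin M X (\<phi> X a) (\<phi> X b)) \<and>
      (\<forall>a\<in>hcar L X. \<phi> X (hneg L X a) = hneg M X (\<phi> X a)) \<and>
      \<phi> X (hzero L X) = hzero M X \<and>
      \<phi> X (hone L X) = hone M X \<and>
      (\<forall>x\<in>X. \<forall>a\<in>hcar L X. \<phi> X (hex L X x a) = hex M X x (\<phi> X a)) \<and>
      (\<forall>w\<in>univ (W \<Theta> X). \<forall>w'\<in>univ (W \<Theta> X). \<phi> X (heq L X w w') = heq M X w w') \<and>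
      (\<forall>Y\<in>Sorts X0. \<forall>s\<in>Hom \<Theta> (W \<Theta> X) (W \<Theta> Y). \<forall>a\<in>hcar L X.
        \<phi> Y (hsub L X Y s a) = hsub M X Y s (\<phi> X a))}"

section \<open>The Halmos algebra of an algebra\<close>

definition Hal :: "'f variety \<Rightarrow> ('f, 'h) algebra \<Rightarrow> ('f, 'x, (('f, 'x) word \<Rightarrow> 'h) set) hal" where
  "Hal \<Theta> H = \<lparr>
    hcar = (\<lambda>X. Pow (Hom \<Theta> (W \<Theta> X) H)),
    hmeet = (\<lambda>X A B. A \<inter> B),
    hjoin = (\<lambda>X A B. A \<union> B),
    hneg = (\<lambda>X A. Hom \<Theta> (W \<Theta> X) H - A),
    hzero = (\<lambda>X. {}),
    hone = (\<lambda>X. Hom \<Theta> (W \<Theta> X) H),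
    hex = (\<lambda>X x A. {\<mu> \<in> Hom \<Theta> (W \<Theta> X) H.
      \<exists>\<nu>\<in>A. \<forall>y\<in>X - {x}. \<nu> (gen \<Theta> X y) = \<mu> (gen \<Theta> X y)}),
    heq = (\<lambda>X w w'. {\<mu> \<in> Hom \<Theta> (W \<Theta> X) H. \<mu> w = \<mu> w'}),
    hsub = (\<lambda>X Y s A. {\<mu> \<in> Hom \<Theta> (W \<Theta> Y) H. compose (univ (W \<Theta> X)) \<mu> s \<in> A})\<rparr>"

section \<open>The algebra of formulas\<close>

text \<open>The absolutely free algebra in the signature of Halmos algebras, with the formal
  equalities as constants. Each constructor carries the sort of the formula it builds
  (\<open>FSub X Y s u\<close> has sort \<open>Y\<close>).\<close>

datatype ('f, 'x) fm =
    FMeet "'x set" "('f, 'x) fm" "('f, 'x) fm"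
  | FJoin "'x set" "('f, 'x) fm" "('f, 'x) fm"
  | FNeg "'x set" "('f, 'x) fm"
  | FZero "'x set"
  | FOne "'x set"
  | FEx "'x set" 'x "('f, 'x) fm"
  | FEq "'x set" "('f, 'x) word" "('f, 'x) word"
  | FSub "'x set" "'x set" "('f, 'x) word \<Rightarrow> ('f, 'x) word" "('f, 'x) fm"

inductive is_fm :: "'f variety \<Rightarrow> 'x set \<Rightarrow> 'x set \<Rightarrow> ('f, 'x) fm \<Rightarrow> bool"
  for \<Theta> :: "'f variety" and X0 :: "'x set" where
  "is_fm \<Theta> X0 X u \<Longrightarrow> is_fm \<Theta> X0 X v \<Longrightarrow> is_fm \<Theta> X0 X (FMeet X u v)"
| "is_fm \<Theta> X0 X u \<Longrightarrow> is_fm \<Theta> X0 X v \<Longrightarrow> is_fm \<Theta> X0 X (FJoin X u v)"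
| "is_fm \<Theta> X0 X u \<Longrightarrow> is_fm \<Theta> X0 X (FNeg X u)"
| "X \<in> Sorts X0 \<Longrightarrow> is_fm \<Theta> X0 X (FZero X)"
| "X \<in> Sorts X0 \<Longrightarrow> is_fm \<Theta> X0 X (FOne X)"
| "is_fm \<Theta> X0 X u \<Longrightarrow> x \<in> X \<Longrightarrow> is_fm \<Theta> X0 X (FEx X x u)"
| "X \<in> Sorts X0 \<Longrightarrow> w \<in> univ (W \<Theta> X) \<Longrightarrow> w' \<in> univ (W \<Theta> X) \<Longrightarrow> is_fm \<Theta> X0 X (FEq X w w')"
| "is_fm \<Theta> X0 X u \<Longrightarrow> Y \<in> Sorts X0 \<Longrightarrow> s \<in> Hom \<Theta> (W \<Theta> X) (W \<Theta> Y) \<Longrightarrow>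
    is_fm \<Theta> X0 Y (FSub X Y s u)"

definition Fm :: "'f variety \<Rightarrow> 'x set \<Rightarrow> ('f, 'x, ('f, 'x) fm) hal" where
  "Fm \<Theta> X0 = \<lparr>hcar = (\<lambda>X. {u. is_fm \<Theta> X0 X u}), hmeet = FMeet, hjoin = FJoin, hneg = FNeg,
    hzero = FZero, hone = FOne, hex = FEx, heq = FEq, hsub = FSub\<rparr>"

definition hal_cong ::
  "'f variety \<Rightarrow> 'x set \<Rightarrow> ('f, 'x, 'l) hal \<Rightarrow> ('x set \<Rightarrow> ('l \<times> 'l) set) \<Rightarrow> bool" where
  "hal_cong \<Theta> X0 L \<theta> \<longleftrightarrow> (\<forall>X\<in>Sorts X0.
      equiv (hcar L X) (\<theta> X) \<and>
      (\<forall>(a, a')\<in>\<theta> X. \<forall>(b, b')\<in>\<theta> X. (hmeet L X a b, hmeet L X a' b') \<in> \<theta> X) \<and>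
      (\<forall>(a, a')\<in>\<theta> X. \<forall>(b, b')\<in>\<theta> X. (hjoin L X a b, hjoin L X a' b') \<in> \<theta> X) \<and>
      (\<forall>(a, a')\<in>\<theta> X. (hneg L X a, hneg L X a') \<in> \<theta> X) \<and>
      (\<forall>x\<in>X. \<forall>(a, a')\<in>\<theta> X. (hex L X x a, hex L X x a') \<in> \<theta> X) \<and>
      (\<forall>Y\<in>Sorts X0. \<forall>s\<in>Hom \<Theta> (W \<Theta> X) (W \<Theta> Y). \<forall>(a, a')\<in>\<theta> X.
        (hsub L X Y s a, hsub L X Y s a') \<in> \<theta> Y))"

definition hal_quot ::
  "('f, 'x, 'l) hal \<Rightarrow> ('x set \<Rightarrow> ('l \<times> 'l) set) \<Rightarrow> ('f, 'x, 'l set) hal" where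
  "hal_quot L \<theta> = \<lparr>
    hcar = (\<lambda>X. hcar L X // \<theta> X),
    hmeet = (\<lambda>X A B. \<Union>a\<in>A. \<Union>b\<in>B. \<theta> X `` {hmeet L X a b}),
    hjoin = (\<lambda>X A B. \<Union>a\<in>A. \<Union>b\<in>B. \<theta> X `` {hjoin L X a b}),
    hneg = (\<lambda>X A. \<Union>a\<in>A. \<theta> X `` {hneg L X a}),
    hzero = (\<lambda>X. \<theta> X `` {hzero L X}),
    hone = (\<lambda>X. \<theta> X `` {hone L X}),
    hex = (\<lambda>X x A. \<Union>a\<in>A. \<theta> X `` {hex L X x a}),
    heq = (\<lambda>X w w'. \<theta> X `` {heq L X w w'}),
    hsub = (\<lambda>X Y s A. \<Union>a\<in>A. \<theta> Y `` {hsub L X Y s a})\<rparr>"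

text \<open>\<open>\<Phi>\<close> is the quotient of the absolutely free algebra by its least congruence with a
  Halmos algebra as quotient. That this is the free Halmos algebra over the formal
  equalities is proved at the end of this theory.\<close>

definition halmos_cong :: "'f variety \<Rightarrow> 'x set \<Rightarrow> 'x set \<Rightarrow> (('f, 'x) fm \<times> ('f, 'x) fm) set" where
  "halmos_cong \<Theta> X0 X = \<Inter>{\<theta> X | \<theta>.
    hal_cong \<Theta> X0 (Fm \<Theta> X0) \<theta> \<and> halmos_algebra \<Theta> X0 (hal_quot (Fm \<Theta> X0) \<theta>)}"

definition \<Phi> :: "'f variety \<Rightarrow> 'x set \<Rightarrow> ('f, 'x, ('f, 'x) fm set) hal" where
  "\<Phi> \<Theta> X0 = hal_quot (Fm \<Theta> X0) (halmos_cong \<Theta> X0)"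

definition Val :: "'f variety \<Rightarrow> 'x set \<Rightarrow> ('f, 'h) algebra \<Rightarrow>
    'x set \<Rightarrow> ('f, 'x) fm set \<Rightarrow> (('f, 'x) word \<Rightarrow> 'h) set" where
  "Val \<Theta> X0 H = (THE \<phi>. \<phi> \<in> hal_hom \<Theta> X0 (\<Phi> \<Theta> X0) (Hal \<Theta> H))"

section \<open>Logical geometry\<close>

definition LKer :: "'f variety \<Rightarrow> 'x set \<Rightarrow> ('f, 'h) algebra \<Rightarrow> 'x set \<Rightarrow>
    (('f, 'x) word \<Rightarrow> 'h) \<Rightarrow> ('f, 'x) fm set set" where
  "LKer \<Theta> X0 H X \<mu> = {u \<in> hcar (\<Phi> \<Theta> X0) X. \<mu> \<in> Val \<Theta> X0 H X u}"

definition fm_L :: "'f variety \<Rightarrow> 'x set \<Rightarrow> ('f, 'h) algebra \<Rightarrow> 'x set \<Rightarrow>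
    ('f, 'x) fm set set \<Rightarrow> (('f, 'x) word \<Rightarrow> 'h) set" where
  "fm_L \<Theta> X0 H X T = {\<mu> \<in> Hom \<Theta> (W \<Theta> X) H. T \<subseteq> LKer \<Theta> X0 H X \<mu>}"

text \<open>For the empty set of points this is all of \<open>\<Phi>(X)\<close>.\<close>

definition pt_L :: "'f variety \<Rightarrow> 'x set \<Rightarrow> ('f, 'h) algebra \<Rightarrow> 'x set \<Rightarrow>
    (('f, 'x) word \<Rightarrow> 'h) set \<Rightarrow> ('f, 'x) fm set set" where
  "pt_L \<Theta> X0 H X A = {u \<in> hcar (\<Phi> \<Theta> X0) X. \<forall>\<mu>\<in>A. u \<in> LKer \<Theta> X0 H X \<mu>}"

definition LG_equivalent ::
  "'f variety \<Rightarrow> 'x set \<Rightarrow> ('f, 'a) algebra \<Rightarrow> ('f, 'b) algebra \<Rightarrow> bool" where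
  "LG_equivalent \<Theta> X0 H1 H2 \<longleftrightarrow> (\<forall>X\<in>Sorts X0. \<forall>T\<subseteq>hcar (\<Phi> \<Theta> X0) X.
    pt_L \<Theta> X0 H1 X (fm_L \<Theta> X0 H1 X T) = pt_L \<Theta> X0 H2 X (fm_L \<Theta> X0 H2 X T))"

definition logically_homogeneous :: "'f variety \<Rightarrow> 'x set \<Rightarrow> ('f, 'h) algebra \<Rightarrow> bool" where
  "logically_homogeneous \<Theta> X0 H \<longleftrightarrow>
    (\<forall>X\<in>Sorts X0. \<forall>\<mu>\<in>Hom \<Theta> (W \<Theta> X) H. \<forall>\<nu>\<in>Hom \<Theta> (W \<Theta> X) H.
      LKer \<Theta> X0 H X \<mu> = LKer \<Theta> X0 H X \<nu> \<longleftrightarrow> (\<exists>\<sigma>\<in>Aut \<Theta> H. \<mu> = compose (univ (W \<Theta> X)) \<sigma> \<nu>))"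

definition logically_perfect :: "'f variety \<Rightarrow> 'x set \<Rightarrow> bool" where
  "logically_perfect \<Theta> X0 \<longleftrightarrow> (\<forall>X\<in>Sorts X0. logically_homogeneous \<Theta> X0 (W \<Theta> X))"

text \<open>The algebras \<open>H'\<close> of the variety range over all algebras with elements in the type \<open>'b\<close>;
  a statement that is polymorphic in \<open>'b\<close> covers all algebras.\<close>

definition logically_separable ::
  "'b itself \<Rightarrow> 'f variety \<Rightarrow> 'x set \<Rightarrow> ('f, 'a) algebra \<Rightarrow> bool" where
  "logically_separable (_ :: 'b itself) \<Theta> X0 H \<longleftrightarrow>
    (\<forall>H' :: ('f, 'b) algebra. in_variety \<Theta> H' \<longrightarrow> LG_equivalent \<Theta> X0 H' H \<longrightarrow> isomorphic \<Theta> H' H)"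

definition logically_regular :: "'b itself \<Rightarrow> 'f variety \<Rightarrow> 'x set \<Rightarrow> bool" where
  "logically_regular (b :: 'b itself) \<Theta> X0 \<longleftrightarrow>
    (\<forall>X\<in>Sorts X0. logically_separable b \<Theta> X0 (W \<Theta> X))"

section \<open>Free algebras\<close>

lemma term_cong_terms:
  assumes "is_variety \<Theta>" "(t, u) \<in> term_cong \<Theta> X"
  shows "t \<in> terms \<Theta> X \<and> u \<in> terms \<Theta> X"
proof -
  have sub: "subst \<sigma> l \<in> terms \<Theta> X" if "l \<in> terms \<Theta> UNIV" "range \<sigma> \<subseteq> terms \<Theta> X"
    for l and \<sigma> :: "nat \<Rightarrow> ('a, 'b) trm"
    using that(1)
  proof induction
    case (terms_Var x)
    then show ?case using that(2) by (auto simp: subst_def)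
  next
    case (terms_App ts f)
    then show ?case by (auto simp: subst_def intro!: terms.terms_App)
  qed
  from assms(2) show ?thesis
  proof induction
    case (cong_App ts f us)
    have *: "length us = length ts" "\<And>i. i < length ts \<Longrightarrow> ts ! i \<in> terms \<Theta> X \<and> us ! i \<in> terms \<Theta> X"
      using cong_App(2) by (simp_all add: list_all2_conv_all_nth)
    then have "\<forall>t\<in>set ts. t \<in> terms \<Theta> X" "\<forall>t\<in>set us. t \<in> terms \<Theta> X"
      unfolding all_set_conv_all_nth by simp_all
    then show ?case using cong_App(1) *(1) by (simp add: terms.terms_App)
  next
    case (cong_ident l r \<sigma>)
    then have "l \<in> terms \<Theta> UNIV" "r \<in> terms \<Theta> UNIV"
      using assms(1) by (auto simp: is_variety_def)
    then show ?case using sub cong_ident(2) by blast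
  qed auto
qed

lemma equiv_term_cong:
  assumes "is_variety \<Theta>"
  shows "equiv (terms \<Theta> X) (term_cong \<Theta> X)"
proof (rule equivI)
  show "term_cong \<Theta> X \<subseteq> terms \<Theta> X \<times> terms \<Theta> X"
    using term_cong_terms[OF assms] by auto
  show "refl_on (terms \<Theta> X) (term_cong \<Theta> X)"
    by (auto intro!: refl_onI cong_refl)
  show "sym (term_cong \<Theta> X)"
    by (rule symI) (rule cong_sym)
  show "trans (term_cong \<Theta> X)"
    by (rule transI) (rule cong_trans)
qed

lemma listset_iff: "ts \<in> listset as \<longleftrightarrow> list_all2 (\<in>) ts as"
proof (induction as arbitrary: ts)
  case (Cons a as)
  then show ?case by (cases ts) (auto simp: set_Cons_def)
qed simp

lemma ops_W:
  assumes "is_variety \<Theta>" "length ts = arity \<Theta> f" "set ts \<subseteq> terms \<Theta> X"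
  shows "ops (W \<Theta> X) f (map (\<lambda>t. term_cong \<Theta> X `` {t}) ts) = term_cong \<Theta> X `` {App f ts}"
proof -
  have "ts \<in> listset (map (\<lambda>t. term_cong \<Theta> X `` {t}) ts)"
    unfolding listset_iff using assms(3)
    by (auto simp: list_all2_conv_all_nth subset_iff intro!: cong_refl)
  moreover have "term_cong \<Theta> X `` {App f us} = term_cong \<Theta> X `` {App f ts}"
    if "us \<in> listset (map (\<lambda>t. term_cong \<Theta> X `` {t}) ts)" for us
  proof -
    from that have "list_all2 (\<lambda>t u. (t, u) \<in> term_cong \<Theta> X) ts us"
      unfolding listset_iff by (auto simp: list_all2_conv_all_nth)
    then have "(App f ts, App f us) \<in> term_cong \<Theta> X"
      using assms(2) by (intro cong_App) auto
    then show ?thesis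
      using equiv_class_eq[OF equiv_term_cong[OF assms(1)]] by metis
  qed
  ultimately show ?thesis unfolding W_def algebra.simps by blast
qed

lemma univ_W: "univ (W \<Theta> X) = terms \<Theta> X // term_cong \<Theta> X"
  by (simp add: W_def)

lemma W_reps:
  assumes "set as \<subseteq> univ (W \<Theta> X)"
  obtains ts where "as = map (\<lambda>t. term_cong \<Theta> X `` {t}) ts" "set ts \<subseteq> terms \<Theta> X"
proof -
  have "\<forall>a\<in>set as. \<exists>t. t \<in> terms \<Theta> X \<and> a = term_cong \<Theta> X `` {t}"
    using assms by (auto simp: W_def elim!: quotientE)
  then obtain r where r: "\<forall>a\<in>set as. r a \<in> terms \<Theta> X \<and> term_cong \<Theta> X `` {r a} = a"
    by metis
  then have "map (\<lambda>t. term_cong \<Theta> X `` {t}) (map r as) = as"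
    by (simp add: map_idI)
  then show thesis
    using r by (intro that[of "map r as"]) auto
qed

lemma W_closed:
  assumes "is_variety \<Theta>" "length as = arity \<Theta> f" "set as \<subseteq> univ (W \<Theta> X)"
  shows "ops (W \<Theta> X) f as \<in> univ (W \<Theta> X)"
proof -
  obtain ts where ts: "as = map (\<lambda>t. term_cong \<Theta> X `` {t}) ts" "set ts \<subseteq> terms \<Theta> X"
    using W_reps[OF assms(3)] by metis
  then have "App f ts \<in> terms \<Theta> X"
    using assms(2) by (auto intro: terms.intros)
  then show ?thesis
    using ops_W[OF assms(1), of ts f X] ts assms(2) by (simp add: quotientI univ_W)
qed

theorem W_in_variety:
  assumes "is_variety \<Theta>"
  shows "in_variety \<Theta> (W \<Theta> X)"
proof -
  have "tval (W \<Theta> X) v l = tval (W \<Theta> X) v r"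
    if lr: "(l, r) \<in> idents \<Theta>" and v: "range v \<subseteq> univ (W \<Theta> X)" for l r v
  proof -
    have "\<forall>n. \<exists>t. t \<in> terms \<Theta> X \<and> v n = term_cong \<Theta> X `` {t}"
    proof
      fix n
      have "v n \<in> terms \<Theta> X // term_cong \<Theta> X" using v by (auto simp: univ_W)
      then show "\<exists>t. t \<in> terms \<Theta> X \<and> v n = term_cong \<Theta> X `` {t}" by (auto elim: quotientE)
    qed
    then obtain \<sigma> where \<sigma>: "\<And>n. \<sigma> n \<in> terms \<Theta> X" "\<And>n. v n = term_cong \<Theta> X `` {\<sigma> n}"
      by metis
    have *: "subst \<sigma> t \<in> terms \<Theta> X \<and> tval (W \<Theta> X) v t = term_cong \<Theta> X `` {subst \<sigma> t}"
      if "t \<in> terms \<Theta> UNIV" for t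
      using that
    proof induction
      case (terms_Var x)
      then show ?case using \<sigma> by (simp add: subst_def)
    next
      case (terms_App ts f)
      then have "map (tval (W \<Theta> X) v) ts = map (\<lambda>t. term_cong \<Theta> X `` {t}) (map (subst \<sigma>) ts)"
        by auto
      moreover have "set (map (subst \<sigma>) ts) \<subseteq> terms \<Theta> X"
        using terms_App by auto
      ultimately have "tval (W \<Theta> X) v (App f ts) = term_cong \<Theta> X `` {App f (map (subst \<sigma>) ts)}"
        using ops_W[OF assms, of "map (subst \<sigma>) ts" f X] terms_App(1)
        by (simp only: tval.simps length_map)
      moreover have "App f (map (subst \<sigma>) ts) \<in> terms \<Theta> X"
        using terms_App by (intro terms.intros) auto
      ultimately show ?case by (simp add: subst_def)
    qed
    have "(subst \<sigma> l, subst \<sigma> r) \<in> term_cong \<Theta> X"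
      using lr \<sigma>(1) by (intro cong_ident) auto
    then have "term_cong \<Theta> X `` {subst \<sigma> l} = term_cong \<Theta> X `` {subst \<sigma> r}"
      using equiv_class_eq[OF equiv_term_cong[OF assms]] by metis
    moreover have "l \<in> terms \<Theta> UNIV" "r \<in> terms \<Theta> UNIV"
      using assms lr by (auto simp: is_variety_def)
    ultimately show ?thesis using *[of l] *[of r] by metis
  qed
  then show ?thesis
    unfolding in_variety_def using W_closed[OF assms] by blast
qed

lemma gen_in_W: "x \<in> X \<Longrightarrow> gen \<Theta> X x \<in> univ (W \<Theta> X)"
  by (simp add: gen_def univ_W quotientI terms_Var)

lemma tval_in_univ:
  assumes "in_variety \<Theta> H" "t \<in> terms \<Theta> X" "\<And>x. x \<in> X \<Longrightarrow> v x \<in> univ H"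
  shows "tval H v t \<in> univ H"
  using assms(2)
proof induction
  case (terms_App ts f)
  then have "set (map (tval H v) ts) \<subseteq> univ H" by auto
  moreover have "length (map (tval H v) ts) = arity \<Theta> f" using terms_App(1) by simp
  ultimately show ?case using assms(1) unfolding in_variety_def tval.simps by blast
qed (use assms(3) in auto)

lemma tval_term_cong:
  assumes "is_variety \<Theta>" "in_variety \<Theta> H" "(t, u) \<in> term_cong \<Theta> X"
    "\<And>x. x \<in> X \<Longrightarrow> v x \<in> univ H"
  shows "tval H v t = tval H v u"
  using assms(3)
proof induction
  case (cong_App ts f us)
  then have "map (tval H v) ts = map (tval H v) us"
    by (auto simp: list_all2_conv_all_nth list_eq_iff_nth_eq)
  then show ?case by (metis tval.simps(2))
next
  case (cong_ident l r \<sigma>)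
  have *: "tval H v (subst \<sigma> t) = tval H (\<lambda>n. tval H v (\<sigma> n)) t" for t
    by (induction t) (auto simp: subst_def intro!: arg_cong[where f = "ops H _"])
  have "range (\<lambda>n. tval H v (\<sigma> n)) \<subseteq> univ H"
    using tval_in_univ[OF assms(2), of _ X v] assms(4) cong_ident(2) by blast
  then have "tval H (\<lambda>n. tval H v (\<sigma> n)) l = tval H (\<lambda>n. tval H v (\<sigma> n)) r"
    using assms(2) cong_ident(1) unfolding in_variety_def by blast
  then show ?case by (simp add: *)
qed auto

lemma Hom_tval:
  assumes "is_variety \<Theta>" "h \<in> Hom \<Theta> (W \<Theta> X) H" "t \<in> terms \<Theta> X"
  shows "h (term_cong \<Theta> X `` {t}) = tval H (\<lambda>x. h (gen \<Theta> X x)) t"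
  using assms(3)
proof induction
  case (terms_App ts f)
  then have ts: "set ts \<subseteq> terms \<Theta> X" by auto
  have "h (term_cong \<Theta> X `` {App f ts}) = h (ops (W \<Theta> X) f (map (\<lambda>t. term_cong \<Theta> X `` {t}) ts))"
    using ops_W[OF assms(1) terms_App(1) ts] by simp
  also have "\<dots> = ops H f (map h (map (\<lambda>t. term_cong \<Theta> X `` {t}) ts))"
  proof -
    have "set (map (\<lambda>t. term_cong \<Theta> X `` {t}) ts) \<subseteq> univ (W \<Theta> X)"
      using ts by (auto simp: W_def intro: quotientI)
    then show ?thesis using assms(2) terms_App(1) by (simp add: Hom_def)
  qed
  also have "map h (map (\<lambda>t. term_cong \<Theta> X `` {t}) ts) = map (tval H (\<lambda>x. h (gen \<Theta> X x))) ts"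
    using terms_App by auto
  finally show ?case by simp
qed (simp add: gen_def)

text \<open>The universal property of \<open>W(X)\<close>.\<close>

theorem W_free:
  assumes "is_variety \<Theta>" "in_variety \<Theta> H" "\<And>x. x \<in> X \<Longrightarrow> v x \<in> univ H"
  shows "\<exists>!h. h \<in> Hom \<Theta> (W \<Theta> X) H \<and> (\<forall>x\<in>X. h (gen \<Theta> X x) = v x)"
proof (rule ex_ex1I)
  define h where "h = (\<lambda>w\<in>univ (W \<Theta> X). tval H v (SOME t. t \<in> w))"
  have h: "h (term_cong \<Theta> X `` {t}) = tval H v t" if "t \<in> terms \<Theta> X" for t
  proof -
    have "(t, SOME u. u \<in> term_cong \<Theta> X `` {t}) \<in> term_cong \<Theta> X"
      using cong_refl[OF that] someI[of "\<lambda>u. u \<in> term_cong \<Theta> X `` {t}" t] by auto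
    then have "tval H v t = tval H v (SOME u. u \<in> term_cong \<Theta> X `` {t})"
      using tval_term_cong[OF assms(1,2), of t _ X v] assms(3) by blast
    then show ?thesis using that by (auto simp: h_def W_def intro: quotientI)
  qed
  have "h \<in> Hom \<Theta> (W \<Theta> X) H"
  proof -
    have "h w \<in> univ H" if "w \<in> univ (W \<Theta> X)" for w
      using that h tval_in_univ[OF assms(2), of _ X v] assms(3)
      by (auto simp: W_def elim!: quotientE)
    moreover have "h (ops (W \<Theta> X) f as) = ops H f (map h as)"
      if as: "length as = arity \<Theta> f" "set as \<subseteq> univ (W \<Theta> X)" for f as
    proof -
      obtain ts where ts: "as = map (\<lambda>t. term_cong \<Theta> X `` {t}) ts" "set ts \<subseteq> terms \<Theta> X"
        using W_reps[OF as(2)] by metis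
      then have "App f ts \<in> terms \<Theta> X"
        using as(1) by (auto intro: terms.intros)
      then have "h (ops (W \<Theta> X) f as) = ops H f (map (tval H v) ts)"
        using ops_W[OF assms(1), of ts f X] ts as(1) h by simp
      also have "map (tval H v) ts = map h as"
        using ts h by auto
      finally show ?thesis .
    qed
    ultimately show ?thesis by (auto simp: Hom_def h_def)
  qed
  moreover have "\<forall>x\<in>X. h (gen \<Theta> X x) = v x"
    using h[OF terms_Var] by (simp add: gen_def)
  ultimately show "\<exists>h. h \<in> Hom \<Theta> (W \<Theta> X) H \<and> (\<forall>x\<in>X. h (gen \<Theta> X x) = v x)"
    by blast
next
  fix h k
  assume hk: "h \<in> Hom \<Theta> (W \<Theta> X) H \<and> (\<forall>x\<in>X. h (gen \<Theta> X x) = v x)"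
    "k \<in> Hom \<Theta> (W \<Theta> X) H \<and> (\<forall>x\<in>X. k (gen \<Theta> X x) = v x)"
  show "h = k"
  proof (rule extensionalityI)
    show "h \<in> extensional (univ (W \<Theta> X))" "k \<in> extensional (univ (W \<Theta> X))"
      using hk by (auto simp: Hom_def PiE_def)
    fix w assume "w \<in> univ (W \<Theta> X)"
    then obtain t where t: "w = term_cong \<Theta> X `` {t}" "t \<in> terms \<Theta> X"
      by (auto simp: W_def elim!: quotientE)
    have "tval H (\<lambda>x. h (gen \<Theta> X x)) t = tval H (\<lambda>x. k (gen \<Theta> X x)) t"
      using t(2)
    proof induction
      case (terms_App ts f)
      then have "map (tval H (\<lambda>x. h (gen \<Theta> X x))) ts = map (tval H (\<lambda>x. k (gen \<Theta> X x))) ts"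
        by simp
      then show ?case by (simp only: tval.simps)
    qed (use hk in auto)
    then show "h w = k w"
      using Hom_tval[OF assms(1) _ t(2), of h H] Hom_tval[OF assms(1) _ t(2), of k H] hk t(1)
      by simp
  qed
qed

section \<open>\<open>Hal(H)\<close> is a Halmos algebra\<close>

lemma Hom_in: "h \<in> Hom \<Theta> A B \<Longrightarrow> a \<in> univ A \<Longrightarrow> h a \<in> univ B"
  by (auto simp: Hom_def)

lemma Hom_compose:
  assumes "in_variety \<Theta> A" "g \<in> Hom \<Theta> A B" "h \<in> Hom \<Theta> B C"
  shows "compose (univ A) h g \<in> Hom \<Theta> A C"
proof -
  have "compose (univ A) h g (ops A f as) = ops C f (map (compose (univ A) h g) as)"
    if as: "length as = arity \<Theta> f" "set as \<subseteq> univ A" for f as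
  proof -
    have "ops A f as \<in> univ A"
      using assms(1) as unfolding in_variety_def by blast
    then have "compose (univ A) h g (ops A f as) = h (g (ops A f as))"
      by (simp add: compose_eq)
    also have "\<dots> = h (ops B f (map g as))"
      using assms(2) as by (simp add: Hom_def)
    also have "\<dots> = ops C f (map h (map g as))"
    proof -
      have "set (map g as) \<subseteq> univ B" using Hom_in[OF assms(2)] as(2) by auto
      then show ?thesis using assms(3) as(1) by (simp add: Hom_def)
    qed
    also have "map h (map g as) = map (compose (univ A) h g) as"
      using as(2) by (auto simp: compose_eq)
    finally show ?thesis .
  qed
  moreover have "compose (univ A) h g \<in> univ A \<rightarrow>\<^sub>E univ C"
    using Hom_in[OF assms(2)] Hom_in[OF assms(3)] by (auto simp: compose_def)
  ultimately show ?thesis by (simp add: Hom_def)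
qed

lemma Hom_W_eqI:
  assumes "is_variety \<Theta>" "in_variety \<Theta> H" "h \<in> Hom \<Theta> (W \<Theta> X) H" "k \<in> Hom \<Theta> (W \<Theta> X) H"
    "\<And>x. x \<in> X \<Longrightarrow> h (gen \<Theta> X x) = k (gen \<Theta> X x)"
  shows "h = k"
proof -
  have "\<exists>!h. h \<in> Hom \<Theta> (W \<Theta> X) H \<and> (\<forall>x\<in>X. h (gen \<Theta> X x) = k (gen \<Theta> X x))"
    using assms(1,2) Hom_in[OF assms(4) gen_in_W] by (intro W_free)
  moreover have "h \<in> Hom \<Theta> (W \<Theta> X) H \<and> (\<forall>x\<in>X. h (gen \<Theta> X x) = k (gen \<Theta> X x))"
    "k \<in> Hom \<Theta> (W \<Theta> X) H \<and> (\<forall>x\<in>X. k (gen \<Theta> X x) = k (gen \<Theta> X x))"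
    using assms(3-5) by auto
  ultimately show ?thesis by (elim ex1E) metis
qed

lemma Hom_W_ex:
  assumes "is_variety \<Theta>" "in_variety \<Theta> H" "\<And>x. x \<in> X \<Longrightarrow> v x \<in> univ H"
  shows "\<exists>h\<in>Hom \<Theta> (W \<Theta> X) H. \<forall>x\<in>X. h (gen \<Theta> X x) = v x"
proof -
  have "\<exists>!h. h \<in> Hom \<Theta> (W \<Theta> X) H \<and> (\<forall>x\<in>X. h (gen \<Theta> X x) = v x)"
    using assms by (intro W_free)
  then show ?thesis by blast
qed

lemma avoids_eq:
  assumes "is_variety \<Theta>" "h \<in> Hom \<Theta> (W \<Theta> Y) H" "k \<in> Hom \<Theta> (W \<Theta> Y) H"
    "avoids \<Theta> Y y w" "w \<in> univ (W \<Theta> Y)"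
    "\<And>z. z \<in> Y - {y} \<Longrightarrow> h (gen \<Theta> Y z) = k (gen \<Theta> Y z)"
  shows "h w = k w"
proof -
  obtain t where t: "t \<in> w" "t \<in> terms \<Theta> (Y - {y})"
    using assms(4) by (auto simp: avoids_def)
  from t(2) have t': "t \<in> terms \<Theta> Y"
  proof induction
    case (terms_App ts f)
    then show ?case by (simp add: terms.terms_App)
  qed (simp add: terms_Var)
  obtain u where u: "w = term_cong \<Theta> Y `` {u}"
    using assms(5) unfolding univ_W by (elim quotientE)
  then have w: "w = term_cong \<Theta> Y `` {t}"
    using t(1) equiv_class_eq[OF equiv_term_cong[OF assms(1)], of u t Y] by simp
  from t(2) have "tval H (\<lambda>x. h (gen \<Theta> Y x)) t = tval H (\<lambda>x. k (gen \<Theta> Y x)) t"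
  proof induction
    case (terms_App ts f)
    then have "map (tval H (\<lambda>x. h (gen \<Theta> Y x))) ts = map (tval H (\<lambda>x. k (gen \<Theta> Y x))) ts"
      by simp
    then show ?case by (simp only: tval.simps)
  qed (use assms(6) in simp)
  then show ?thesis
    using Hom_tval[OF assms(1,2) t'] Hom_tval[OF assms(1,3) t'] w by simp
qed

theorem Hal_halmos_algebra:
  fixes H :: "('f, 'h) algebra" and X0 :: "'x set"
  assumes \<Theta>: "is_variety \<Theta>" and H: "in_variety \<Theta> H"
  shows "halmos_algebra \<Theta> X0 (Hal \<Theta> H :: ('f, 'x, (('f, 'x) word \<Rightarrow> 'h) set) hal)"
proof -
  let ?L = "Hal \<Theta> H :: ('f, 'x, (('f, 'x) word \<Rightarrow> 'h) set) hal"
  have WW: "in_variety \<Theta> (W \<Theta> X)" for X :: "'x set" by (rule W_in_variety[OF \<Theta>])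
  note comp = Hom_compose[OF WW]
  note gW = gen_in_W[where \<Theta> = \<Theta>]
  have sub_iff: "\<mu> \<in> hsub ?L X Y s A \<longleftrightarrow>
      \<mu> \<in> Hom \<Theta> (W \<Theta> Y) H \<and> compose (univ (W \<Theta> X)) \<mu> s \<in> A" for \<mu> X Y s A
    by (simp add: Hal_def)
  have ex_iff: "\<mu> \<in> hex ?L X x A \<longleftrightarrow> \<mu> \<in> Hom \<Theta> (W \<Theta> X) H \<and>
      (\<exists>\<nu>\<in>A. \<forall>y\<in>X - {x}. \<nu> (gen \<Theta> X y) = \<mu> (gen \<Theta> X y))" for \<mu> X x A
    by (simp add: Hal_def)
  have struct: "hal_structure \<Theta> X0 ?L"
    by unfold_locales (auto simp: Hal_def)
  have comm: "hex ?L X x (hex ?L X y A) \<subseteq> hex ?L X y (hex ?L X x A)"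
    if A: "A \<subseteq> Hom \<Theta> (W \<Theta> X) H" for X x y A
  proof
    fix \<mu> assume "\<mu> \<in> hex ?L X x (hex ?L X y A)"
    then obtain \<nu> \<kappa> where *: "\<mu> \<in> Hom \<Theta> (W \<Theta> X) H" "\<nu> \<in> Hom \<Theta> (W \<Theta> X) H" "\<kappa> \<in> A"
      "\<forall>z\<in>X - {x}. \<nu> (gen \<Theta> X z) = \<mu> (gen \<Theta> X z)" "\<forall>z\<in>X - {y}. \<kappa> (gen \<Theta> X z) = \<nu> (gen \<Theta> X z)"
      by (auto simp: Hal_def)
    then have \<kappa>: "\<kappa> \<in> Hom \<Theta> (W \<Theta> X) H" using A by auto
    define v where "v = (\<lambda>z. if z = y then \<kappa> (gen \<Theta> X z) else \<mu> (gen \<Theta> X z))"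
    have "v z \<in> univ H" if "z \<in> X" for z
      using Hom_in[OF *(1) gW[OF that]] Hom_in[OF \<kappa> gW[OF that]] by (cases "z = y") (simp_all add: v_def)
    then obtain \<rho> where \<rho>: "\<rho> \<in> Hom \<Theta> (W \<Theta> X) H" "\<forall>z\<in>X. \<rho> (gen \<Theta> X z) = v z"
      using Hom_W_ex[OF \<Theta> H, of X v] by auto
    have "\<forall>z\<in>X - {y}. \<rho> (gen \<Theta> X z) = \<mu> (gen \<Theta> X z)" using \<rho>(2) by (simp add: v_def)
    moreover have "\<forall>z\<in>X - {x}. \<kappa> (gen \<Theta> X z) = \<rho> (gen \<Theta> X z)" using \<rho>(2) *(4,5) by (simp add: v_def)
    ultimately show "\<mu> \<in> hex ?L X y (hex ?L X x A)"
      using *(1,3) \<rho>(1) by (auto simp: Hal_def)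
  qed
  show ?thesis
  proof (intro halmos_algebra.intro struct halmos_algebra_axioms.intro, goal_cases)
    case (11 X x a b)
    show ?case
    proof (intro equalityI subsetI)
      fix \<mu> assume "\<mu> \<in> hex ?L X x (hmeet ?L X a (hex ?L X x b))"
      then obtain \<nu> \<kappa> where "\<mu> \<in> Hom \<Theta> (W \<Theta> X) H" "\<nu> \<in> a" "\<kappa> \<in> b"
        "\<forall>z\<in>X - {x}. \<nu> (gen \<Theta> X z) = \<mu> (gen \<Theta> X z)"
        "\<forall>z\<in>X - {x}. \<kappa> (gen \<Theta> X z) = \<nu> (gen \<Theta> X z)"
        by (auto simp: Hal_def)
      moreover from this have "\<forall>z\<in>X - {x}. \<kappa> (gen \<Theta> X z) = \<mu> (gen \<Theta> X z)" by simp
      ultimately show "\<mu> \<in> hmeet ?L X (hex ?L X x a) (hex ?L X x b)"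
        by (auto simp: Hal_def)
    next
      fix \<mu> assume "\<mu> \<in> hmeet ?L X (hex ?L X x a) (hex ?L X x b)"
      then obtain \<nu> \<kappa> where "\<mu> \<in> Hom \<Theta> (W \<Theta> X) H" "\<nu> \<in> a" "\<kappa> \<in> b"
        "\<forall>z\<in>X - {x}. \<nu> (gen \<Theta> X z) = \<mu> (gen \<Theta> X z)"
        "\<forall>z\<in>X - {x}. \<kappa> (gen \<Theta> X z) = \<mu> (gen \<Theta> X z)"
        by (auto simp: Hal_def)
      moreover from this have "\<forall>z\<in>X - {x}. \<kappa> (gen \<Theta> X z) = \<nu> (gen \<Theta> X z)" by simp
      moreover have "\<nu> \<in> Hom \<Theta> (W \<Theta> X) H" using \<open>\<nu> \<in> a\<close> 11(3) by (auto simp: Hal_def)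
      ultimately show "\<mu> \<in> hex ?L X x (hmeet ?L X a (hex ?L X x b))"
        unfolding Hal_def hal.simps by blast
    qed
  next
    case (12 X x y a)
    then show ?case using comm[of a X] by (simp add: Hal_def subset_antisym)
  next
    case (14 X ws f ws')
    have "length ws = length ws'" using 14(2,3) by simp
    then have "foldr (hmeet ?L X) (map2 (heq ?L X) ws ws') (hone ?L X)
        = {\<mu> \<in> Hom \<Theta> (W \<Theta> X) H. map \<mu> ws = map \<mu> ws'}"
      by (induction ws ws' rule: list_induct2) (auto simp: Hal_def)
    moreover have "\<mu> (ops (W \<Theta> X) f ws) = \<mu> (ops (W \<Theta> X) f ws')"
      if "\<mu> \<in> Hom \<Theta> (W \<Theta> X) H" "map \<mu> ws = map \<mu> ws'" for \<mu>
      using that 14 by (simp add: Hom_def)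
    ultimately show ?case unfolding hle_def by (auto simp: Hal_def)
  next
    case (17 X Y s a)
    show ?case using comp[OF 17(3)] by (auto simp: Hal_def)
  next
    case (18 X Y s)
    show ?case by (simp add: Hal_def)
  next
    case (19 X Y s)
    show ?case using comp[OF 19(3)] by (auto simp: Hal_def)
  next
    case (20 X a)
    have "compose (univ (W \<Theta> X)) \<mu> (restrict id (univ (W \<Theta> X))) = \<mu>"
      if "\<mu> \<in> Hom \<Theta> (W \<Theta> X) H" for \<mu>
      using that by (intro extensionalityI[of _ "univ (W \<Theta> X)"]) (auto simp: compose_eq Hom_def PiE_def)
    then show ?case using 20 by (auto simp: Hal_def)
  next
    case (21 X Y Z s s' a)
    have "compose (univ (W \<Theta> X)) (compose (univ (W \<Theta> Y)) \<mu> s') s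
        = compose (univ (W \<Theta> X)) \<mu> (compose (univ (W \<Theta> X)) s' s)" for \<mu> :: "('f, 'x) word \<Rightarrow> 'h"
      using Hom_in[OF 21(4)] by (auto simp: compose_def fun_eq_iff)
    then show ?case using comp[OF 21(5)] by (auto simp: Hal_def)
  next
    case (22 X Y s s' x a)
    have *: "compose (univ (W \<Theta> X)) \<mu> s (gen \<Theta> X y) = compose (univ (W \<Theta> X)) \<mu> s' (gen \<Theta> X y)"
      if "y \<in> X - {x}" for y and \<mu> :: "('f, 'x) word \<Rightarrow> 'h"
      using 22(7)[OF that] gW[of y X] that by (simp add: compose_eq)
    show ?case using comp[OF 22(3)] comp[OF 22(4)] by (auto simp: Hal_def *)
  next
    case (23 X Y s x y a)
    have s: "compose (univ (W \<Theta> X)) \<mu> s (gen \<Theta> X z) = \<mu> (s (gen \<Theta> X z))"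
      if "z \<in> X" for z and \<mu> :: "('f, 'x) word \<Rightarrow> 'h"
      using gW[OF that] by (simp add: compose_eq)
    show ?case
    proof (rule set_eqI iffI)+
      fix \<mu> assume "\<mu> \<in> hsub ?L X Y s (hex ?L X x a)"
      then obtain \<nu> where \<nu>: "\<mu> \<in> Hom \<Theta> (W \<Theta> Y) H" "\<nu> \<in> a"
        "\<forall>z\<in>X - {x}. \<nu> (gen \<Theta> X z) = compose (univ (W \<Theta> X)) \<mu> s (gen \<Theta> X z)"
        by (auto simp: sub_iff ex_iff)
      then have \<nu>': "\<nu> \<in> Hom \<Theta> (W \<Theta> X) H" using 23(6) by (auto simp: Hal_def)
      define v where "v = (\<lambda>z. if z = y then \<nu> (gen \<Theta> X x) else \<mu> (gen \<Theta> Y z))"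
      have "v z \<in> univ H" if "z \<in> Y" for z
        using Hom_in[OF \<nu>(1) gW[OF that]] Hom_in[OF \<nu>' gW[OF 23(4)]] by (simp add: v_def)
      then obtain \<rho> where \<rho>: "\<rho> \<in> Hom \<Theta> (W \<Theta> Y) H" "\<forall>z\<in>Y. \<rho> (gen \<Theta> Y z) = v z"
        using Hom_W_ex[OF \<Theta> H, of Y v] by auto
      have "compose (univ (W \<Theta> X)) \<rho> s = \<nu>"
      proof (rule Hom_W_eqI[OF \<Theta> H comp[OF 23(3) \<rho>(1)] \<nu>'])
        fix z assume z: "z \<in> X"
        show "compose (univ (W \<Theta> X)) \<rho> s (gen \<Theta> X z) = \<nu> (gen \<Theta> X z)"
        proof (cases "z = x")
          case True
          then show ?thesis using s[OF z] 23(5,7) \<rho>(2) by (simp add: v_def)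
        next
          case False
          then have "\<rho> (s (gen \<Theta> X z)) = \<mu> (s (gen \<Theta> X z))"
            using avoids_eq[OF \<Theta> \<rho>(1) \<nu>(1) 23(8)[of z] Hom_in[OF 23(3) gW[OF z]]] \<rho>(2) z False by (simp add: v_def)
          then show ?thesis using s[OF z] \<nu>(3) z False by (metis DiffI singletonD)
        qed
      qed
      moreover have "\<forall>z\<in>Y - {y}. \<rho> (gen \<Theta> Y z) = \<mu> (gen \<Theta> Y z)" using \<rho>(2) by (simp add: v_def)
      ultimately show "\<mu> \<in> hex ?L Y y (hsub ?L X Y s a)"
        unfolding ex_iff using \<nu>(1,2) \<rho>(1) by (intro conjI bexI[of _ \<rho>]) (simp_all add: sub_iff)
    next
      fix \<mu> assume "\<mu> \<in> hex ?L Y y (hsub ?L X Y s a)"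
      then obtain \<rho> where \<rho>: "\<mu> \<in> Hom \<Theta> (W \<Theta> Y) H" "\<rho> \<in> Hom \<Theta> (W \<Theta> Y) H"
        "compose (univ (W \<Theta> X)) \<rho> s \<in> a" "\<forall>z\<in>Y - {y}. \<rho> (gen \<Theta> Y z) = \<mu> (gen \<Theta> Y z)"
        by (auto simp: sub_iff ex_iff)
      have "compose (univ (W \<Theta> X)) \<rho> s (gen \<Theta> X z) = compose (univ (W \<Theta> X)) \<mu> s (gen \<Theta> X z)"
        if z: "z \<in> X - {x}" for z
        using avoids_eq[OF \<Theta> \<rho>(2,1) 23(8)[OF z] Hom_in[OF 23(3) gW[of z X]]] \<rho>(4) z s[of z] by simp
      then show "\<mu> \<in> hsub ?L X Y s (hex ?L X x a)"
        unfolding sub_iff ex_iff using \<rho>(1,3) comp[OF 23(3) \<rho>(1)]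
        by (intro conjI bexI[of _ "compose (univ (W \<Theta> X)) \<rho> s"]) simp_all
    qed
  next
    case (24 X Y s w w')
    show ?case using comp[OF 24(3)] 24(4,5) by (auto simp: Hal_def compose_eq)
  next
    case (25 X x s s' a)
    have "compose (univ (W \<Theta> X)) \<mu> s = compose (univ (W \<Theta> X)) \<mu> s'"
      if \<mu>: "\<mu> \<in> Hom \<Theta> (W \<Theta> X) H" and eq: "\<mu> (s (gen \<Theta> X x)) = \<mu> (s' (gen \<Theta> X x))" for \<mu>
    proof (rule Hom_W_eqI[OF \<Theta> H comp[OF 25(3) \<mu>] comp[OF 25(4) \<mu>]])
      fix z assume z: "z \<in> X"
      then show "compose (univ (W \<Theta> X)) \<mu> s (gen \<Theta> X z) = compose (univ (W \<Theta> X)) \<mu> s' (gen \<Theta> X z)"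
        using eq 25(6,7)[of z] gW[OF z] by (cases "z = x") (simp_all add: compose_eq)
    qed
    then show ?case unfolding hle_def by (auto simp: Hal_def)
  qed (auto simp: Hal_def hle_def)
qed

section \<open>\<open>\<Phi>\<close> is the free Halmos algebra over the formal equalities\<close>

lemma hal_homD:
  assumes "\<phi> \<in> hal_hom \<Theta> X0 K L" "X \<in> Sorts X0"
  shows "a \<in> hcar K X \<Longrightarrow> \<phi> X a \<in> hcar L X"
    and "a \<in> hcar K X \<Longrightarrow> b \<in> hcar K X \<Longrightarrow> \<phi> X (hmeet K X a b) = hmeet L X (\<phi> X a) (\<phi> X b)"
    and "a \<in> hcar K X \<Longrightarrow> b \<in> hcar K X \<Longrightarrow> \<phi> X (hjoin K X a b) = hjoin L X (\<phi> X a) (\<phi> X b)"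
    and "a \<in> hcar K X \<Longrightarrow> \<phi> X (hneg K X a) = hneg L X (\<phi> X a)"
    and "\<phi> X (hzero K X) = hzero L X"
    and "\<phi> X (hone K X) = hone L X"
    and "x \<in> X \<Longrightarrow> a \<in> hcar K X \<Longrightarrow> \<phi> X (hex K X x a) = hex L X x (\<phi> X a)"
    and "w \<in> univ (W \<Theta> X) \<Longrightarrow> w' \<in> univ (W \<Theta> X) \<Longrightarrow> \<phi> X (heq K X w w') = heq L X w w'"
    and "Y \<in> Sorts X0 \<Longrightarrow> s \<in> Hom \<Theta> (W \<Theta> X) (W \<Theta> Y) \<Longrightarrow> a \<in> hcar K X \<Longrightarrow>
      \<phi> Y (hsub K X Y s a) = hsub L X Y s (\<phi> X a)"
proof -
  have "\<phi> X \<in> hcar K X \<rightarrow>\<^sub>E hcar L X"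
    by (rule PiE_mem[OF _ assms(2)]) (use assms(1) in \<open>simp add: hal_hom_def\<close>)
  then show "a \<in> hcar K X \<Longrightarrow> \<phi> X a \<in> hcar L X" by (rule PiE_mem)
qed (use assms in \<open>simp_all add: hal_hom_def\<close>)

lemma (in hal_structure) hal_homI:
  assumes "\<And>X a. X \<in> Sorts X0 \<Longrightarrow> a \<in> hcar L X \<Longrightarrow> f X a \<in> hcar M X"
    and "\<And>X a b. X \<in> Sorts X0 \<Longrightarrow> a \<in> hcar L X \<Longrightarrow> b \<in> hcar L X \<Longrightarrow>
      f X (hmeet L X a b) = hmeet M X (f X a) (f X b)"
    and "\<And>X a b. X \<in> Sorts X0 \<Longrightarrow> a \<in> hcar L X \<Longrightarrow> b \<in> hcar L X \<Longrightarrow>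
      f X (hjoin L X a b) = hjoin M X (f X a) (f X b)"
    and "\<And>X a. X \<in> Sorts X0 \<Longrightarrow> a \<in> hcar L X \<Longrightarrow> f X (hneg L X a) = hneg M X (f X a)"
    and "\<And>X. X \<in> Sorts X0 \<Longrightarrow> f X (hzero L X) = hzero M X"
    and "\<And>X. X \<in> Sorts X0 \<Longrightarrow> f X (hone L X) = hone M X"
    and "\<And>X x a. X \<in> Sorts X0 \<Longrightarrow> x \<in> X \<Longrightarrow> a \<in> hcar L X \<Longrightarrow>
      f X (hex L X x a) = hex M X x (f X a)"
    and "\<And>X w w'. X \<in> Sorts X0 \<Longrightarrow> w \<in> univ (W \<Theta> X) \<Longrightarrow> w' \<in> univ (W \<Theta> X) \<Longrightarrow>
      f X (heq L X w w') = heq M X w w'"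
    and "\<And>X Y s a. X \<in> Sorts X0 \<Longrightarrow> Y \<in> Sorts X0 \<Longrightarrow> s \<in> Hom \<Theta> (W \<Theta> X) (W \<Theta> Y) \<Longrightarrow>
      a \<in> hcar L X \<Longrightarrow> f Y (hsub L X Y s a) = hsub M X Y s (f X a)"
  shows "(\<lambda>X\<in>Sorts X0. \<lambda>a\<in>hcar L X. f X a) \<in> hal_hom \<Theta> X0 L M"
proof -
  have "(\<lambda>X\<in>Sorts X0. \<lambda>a\<in>hcar L X. f X a) \<in> (\<Pi>\<^sub>E X\<in>Sorts X0. hcar L X \<rightarrow>\<^sub>E hcar M X)"
    using assms(1) by auto
  then show ?thesis
    unfolding hal_hom_def
    by (simp add: assms meet_closed join_closed neg_closed zero_closed one_closed ex_closed
        eq_closed sub_closed)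
qed

lemma hal_congD:
  assumes "hal_cong \<Theta> X0 L \<theta>" "X \<in> Sorts X0"
  shows "equiv (hcar L X) (\<theta> X)"
    and "(a, a') \<in> \<theta> X \<Longrightarrow> (b, b') \<in> \<theta> X \<Longrightarrow> (hmeet L X a b, hmeet L X a' b') \<in> \<theta> X"
    and "(a, a') \<in> \<theta> X \<Longrightarrow> (b, b') \<in> \<theta> X \<Longrightarrow> (hjoin L X a b, hjoin L X a' b') \<in> \<theta> X"
    and "(a, a') \<in> \<theta> X \<Longrightarrow> (hneg L X a, hneg L X a') \<in> \<theta> X"
    and "x \<in> X \<Longrightarrow> (a, a') \<in> \<theta> X \<Longrightarrow> (hex L X x a, hex L X x a') \<in> \<theta> X"
    and "Y \<in> Sorts X0 \<Longrightarrow> s \<in> Hom \<Theta> (W \<Theta> X) (W \<Theta> Y) \<Longrightarrow> (a, a') \<in> \<theta> X \<Longrightarrow>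
      (hsub L X Y s a, hsub L X Y s a') \<in> \<theta> Y"
proof -
  note c = assms(1)[unfolded hal_cong_def, rule_format, OF assms(2)]
  show "equiv (hcar L X) (\<theta> X)" using c by (rule conjunct1)
qed (use assms in \<open>auto simp: hal_cong_def Ball_def\<close>)

lemma quot_simps:
  assumes \<theta>: "hal_cong \<Theta> X0 L \<theta>" and X: "X \<in> Sorts X0"
  shows "a \<in> hcar L X \<Longrightarrow> b \<in> hcar L X \<Longrightarrow>
      hmeet (hal_quot L \<theta>) X (\<theta> X `` {a}) (\<theta> X `` {b}) = \<theta> X `` {hmeet L X a b}" (is "PROP ?A1")
    and "a \<in> hcar L X \<Longrightarrow> b \<in> hcar L X \<Longrightarrow>
      hjoin (hal_quot L \<theta>) X (\<theta> X `` {a}) (\<theta> X `` {b}) = \<theta> X `` {hjoin L X a b}" (is "PROP ?A2")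
    and "a \<in> hcar L X \<Longrightarrow> hneg (hal_quot L \<theta>) X (\<theta> X `` {a}) = \<theta> X `` {hneg L X a}" (is "PROP ?A3")
    and "x \<in> X \<Longrightarrow> a \<in> hcar L X \<Longrightarrow>
      hex (hal_quot L \<theta>) X x (\<theta> X `` {a}) = \<theta> X `` {hex L X x a}" (is "PROP ?A4")
    and "Y \<in> Sorts X0 \<Longrightarrow> s \<in> Hom \<Theta> (W \<Theta> X) (W \<Theta> Y) \<Longrightarrow> a \<in> hcar L X \<Longrightarrow>
      hsub (hal_quot L \<theta>) X Y s (\<theta> X `` {a}) = \<theta> Y `` {hsub L X Y s a}" (is "PROP ?A5")
proof -
  have eq: "equiv (hcar L Y) (\<theta> Y)" if "Y \<in> Sorts X0" for Y
    by (rule hal_congD(1)[OF \<theta> that])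
  note cls = equiv_class_eq[OF eq]
  note c = hal_congD[OF \<theta> X]
  show "PROP ?A1"
  proof -
    assume a: "a \<in> hcar L X" "b \<in> hcar L X"
    have "(\<lambda>a b. \<theta> X `` {hmeet L X a b}) respects2 \<theta> X"
      by (intro congruent2I' cls[OF X] c)
    then show ?thesis using UN_equiv_class2[OF eq[OF X] eq[OF X]] a by (simp add: hal_quot_def)
  qed
  show "PROP ?A2"
  proof -
    assume a: "a \<in> hcar L X" "b \<in> hcar L X"
    have "(\<lambda>a b. \<theta> X `` {hjoin L X a b}) respects2 \<theta> X"
      by (intro congruent2I' cls[OF X] c)
    then show ?thesis using UN_equiv_class2[OF eq[OF X] eq[OF X]] a by (simp add: hal_quot_def)
  qed
  show "PROP ?A3"
  proof -
    assume a: "a \<in> hcar L X"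
    have "(\<lambda>a. \<theta> X `` {hneg L X a}) respects \<theta> X"
      by (intro congruentI cls[OF X] c)
    then show ?thesis using UN_equiv_class[OF eq[OF X]] a by (simp add: hal_quot_def)
  qed
  show "PROP ?A4"
  proof -
    assume a: "x \<in> X" "a \<in> hcar L X"
    have "(\<lambda>a. \<theta> X `` {hex L X x a}) respects \<theta> X"
      by (intro congruentI cls[OF X] c a(1))
    then show ?thesis using UN_equiv_class[OF eq[OF X]] a by (simp add: hal_quot_def)
  qed
  show "PROP ?A5"
  proof -
    assume a: "Y \<in> Sorts X0" "s \<in> Hom \<Theta> (W \<Theta> X) (W \<Theta> Y)" "a \<in> hcar L X"
    have "(\<lambda>a. \<theta> Y `` {hsub L X Y s a}) respects \<theta> X"
      by (intro congruentI cls[OF a(1)] c a(1,2))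
    then show ?thesis using UN_equiv_class[OF eq[OF X]] a by (simp add: hal_quot_def)
  qed
qed

lemma hal_quot_carI: "a \<in> hcar L X \<Longrightarrow> \<theta> X `` {a} \<in> hcar (hal_quot L \<theta>) X"
  by (simp add: hal_quot_def quotientI)

lemma hal_quot_carE:
  assumes "A \<in> hcar (hal_quot L \<theta>) X"
  obtains a where "a \<in> hcar L X" "A = \<theta> X `` {a}"
  using assms by (auto simp: hal_quot_def elim: quotientE)

lemma hal_quot_consts:
  "hzero (hal_quot L \<theta>) X = \<theta> X `` {hzero L X}"
  "hone (hal_quot L \<theta>) X = \<theta> X `` {hone L X}"
  "heq (hal_quot L \<theta>) X w w' = \<theta> X `` {heq L X w w'}"
  by (simp_all add: hal_quot_def)

lemma hal_quot_structure:
  assumes "hal_structure \<Theta> X0 L" "hal_cong \<Theta> X0 L \<theta>"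
  shows "hal_structure \<Theta> X0 (hal_quot L \<theta>)"
proof -
  interpret hal_structure \<Theta> X0 L by fact
  show ?thesis
    by unfold_locales
      (auto elim!: hal_quot_carE simp: quot_simps[OF assms(2)] hal_quot_consts
        intro!: hal_quot_carI meet_closed join_closed neg_closed zero_closed one_closed ex_closed
          eq_closed sub_closed)
qed

lemma hal_quot_canonical:
  assumes "hal_structure \<Theta> X0 L" "hal_cong \<Theta> X0 L \<theta>"
  shows "(\<lambda>X\<in>Sorts X0. \<lambda>a\<in>hcar L X. \<theta> X `` {a}) \<in> hal_hom \<Theta> X0 L (hal_quot L \<theta>)"
proof -
  interpret hal_structure \<Theta> X0 L by fact
  show ?thesis
    by (rule hal_homI) (simp_all add: quot_simps[OF assms(2)] hal_quot_consts hal_quot_carI)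
qed

lemma hal_quot_factor:
  assumes K: "hal_structure \<Theta> X0 K" and \<theta>: "hal_cong \<Theta> X0 K \<theta>" and h: "h \<in> hal_hom \<Theta> X0 K L"
    and ker: "\<And>X a b. X \<in> Sorts X0 \<Longrightarrow> (a, b) \<in> \<theta> X \<Longrightarrow> h X a = h X b"
  shows "\<exists>g\<in>hal_hom \<Theta> X0 (hal_quot K \<theta>) L.
    \<forall>X\<in>Sorts X0. \<forall>a\<in>hcar K X. g X (\<theta> X `` {a}) = h X a"
proof -
  interpret K: hal_structure \<Theta> X0 K by fact
  interpret Q: hal_structure \<Theta> X0 "hal_quot K \<theta>" by (rule hal_quot_structure) fact+
  define f where "f = (\<lambda>X A. h X (SOME a. a \<in> A))"
  have f: "f X (\<theta> X `` {a}) = h X a" if "X \<in> Sorts X0" "a \<in> hcar K X" for X a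
  proof -
    have "a \<in> \<theta> X `` {a}"
      using equiv_class_self[OF hal_congD(1)[OF \<theta> that(1)] that(2)] .
    then have "(a, SOME b. b \<in> \<theta> X `` {a}) \<in> \<theta> X"
      using someI[of "\<lambda>b. b \<in> \<theta> X `` {a}" a] by simp
    then show ?thesis using ker[OF that(1)] unfolding f_def by metis
  qed
  let ?g = "\<lambda>X\<in>Sorts X0. \<lambda>A\<in>hcar (hal_quot K \<theta>) X. f X A"
  have "?g \<in> hal_hom \<Theta> X0 (hal_quot K \<theta>) L"
    by (rule Q.hal_homI)
      (auto elim!: hal_quot_carE simp: quot_simps[OF \<theta>] hal_quot_consts f hal_homD[OF h]
        K.meet_closed K.join_closed K.neg_closed K.zero_closed K.one_closed K.ex_closed
        K.eq_closed K.sub_closed)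
  moreover have "\<forall>X\<in>Sorts X0. \<forall>a\<in>hcar K X. ?g X (\<theta> X `` {a}) = h X a"
    by (simp add: f hal_quot_carI)
  ultimately show ?thesis by blast
qed

lemma hal_hom_kernel:
  assumes K: "hal_structure \<Theta> X0 K" and h: "h \<in> hal_hom \<Theta> X0 K L"
  shows "hal_cong \<Theta> X0 K (\<lambda>X. {(a, b). a \<in> hcar K X \<and> b \<in> hcar K X \<and> h X a = h X b})"
proof -
  interpret K: hal_structure \<Theta> X0 K by fact
  have "equiv (hcar K X) {(a, b). a \<in> hcar K X \<and> b \<in> hcar K X \<and> h X a = h X b}" for X
    by (rule equivI) (auto intro!: refl_onI symI transI)
  then show ?thesis
    unfolding hal_cong_def
    by (simp add: hal_homD[OF h] K.meet_closed K.join_closed K.neg_closed K.ex_closed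
        K.sub_closed split_beta)
qed

text \<open>The Halmos axioms are equations, so they are inherited along jointly injective families of
  homomorphisms into Halmos algebras.\<close>

lemma halmos_algebra_separated:
  assumes \<Theta>: "is_variety \<Theta>" and K: "hal_structure \<Theta> X0 K"
    and L: "\<And>i. i \<in> S \<Longrightarrow> halmos_algebra \<Theta> X0 (L i)"
    and \<phi>: "\<And>i. i \<in> S \<Longrightarrow> \<phi> i \<in> hal_hom \<Theta> X0 K (L i)"
    and sep: "\<And>X a b. \<lbrakk>X \<in> Sorts X0; a \<in> hcar K X; b \<in> hcar K X;
      \<And>i. i \<in> S \<Longrightarrow> \<phi> i X a = \<phi> i X b\<rbrakk> \<Longrightarrow> a = b"
  shows "halmos_algebra \<Theta> X0 K"
proof -
  interpret K: hal_structure \<Theta> X0 K by fact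
  note closed = K.meet_closed K.join_closed K.neg_closed K.zero_closed K.one_closed K.ex_closed
    K.eq_closed K.sub_closed
  note hs = hal_homD[OF \<phi>]
  note wf_ops = W_closed[OF \<Theta>]
  note comp = Hom_compose[OF W_in_variety[OF \<Theta>]]
  have idW: "restrict id (univ (W \<Theta> X)) \<in> Hom \<Theta> (W \<Theta> X) (W \<Theta> X)" for X
  proof -
    have "map (restrict id (univ (W \<Theta> X))) as = as" if "set as \<subseteq> univ (W \<Theta> X)" for as
      using that by (induction as) auto
    then show ?thesis by (simp add: Hom_def wf_ops)
  qed
  show ?thesis
  proof (intro halmos_algebra.intro K halmos_algebra_axioms.intro, goal_cases)
    case (1 X)
    show ?case
      unfolding hle_def
      by (rule sep[of X], (simp_all add: 1 closed)[3], simp add: 1 closed hs, rule halmos_algebra.meet_comm[OF L])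
        (simp_all add: 1 hs)
  next
    case (2 X)
    show ?case
      unfolding hle_def
      by (rule sep[of X], (simp_all add: 2 closed)[3], simp add: 2 closed hs, rule halmos_algebra.join_comm[OF L])
        (simp_all add: 2 hs)
  next
    case (3 X)
    show ?case
      unfolding hle_def
      by (rule sep[of X], (simp_all add: 3 closed)[3], simp add: 3 closed hs, rule halmos_algebra.meet_join_distrib[OF L])
        (simp_all add: 3 hs)
  next
    case (4 X)
    show ?case
      unfolding hle_def
      by (rule sep[of X], (simp_all add: 4 closed)[3], simp add: 4 closed hs, rule halmos_algebra.join_meet_distrib[OF L])
        (simp_all add: 4 hs)
  next
    case (5 X)
    show ?case
      unfolding hle_def
      by (rule sep[of X], (simp_all add: 5 closed)[3], simp add: 5 closed hs, rule halmos_algebra.meet_one[OF L])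
        (simp_all add: 5 hs)
  next
    case (6 X)
    show ?case
      unfolding hle_def
      by (rule sep[of X], (simp_all add: 6 closed)[3], simp add: 6 closed hs, rule halmos_algebra.join_zero[OF L])
        (simp_all add: 6 hs)
  next
    case (7 X)
    show ?case
      unfolding hle_def
      by (rule sep[of X], (simp_all add: 7 closed)[3], simp add: 7 closed hs, rule halmos_algebra.meet_neg[OF L])
        (simp_all add: 7 hs)
  next
    case (8 X)
    show ?case
      unfolding hle_def
      by (rule sep[of X], (simp_all add: 8 closed)[3], simp add: 8 closed hs, rule halmos_algebra.join_neg[OF L])
        (simp_all add: 8 hs)
  next
    case (9 X)
    show ?case
      unfolding hle_def
      by (rule sep[of X], (simp_all add: 9 closed)[3], simp add: 9 closed hs, rule halmos_algebra.ex_zero[OF L])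
        (simp_all add: 9 hs)
  next
    case (10 X)
    show ?case
      unfolding hle_def
      by (rule sep[of X], (simp_all add: 10 closed)[3], simp add: 10 closed hs, rule halmos_algebra.ex_ge[OF L, unfolded hle_def])
        (simp_all add: 10 hs)
  next
    case (11 X)
    show ?case
      unfolding hle_def
      by (rule sep[of X], (simp_all add: 11 closed)[3], simp add: 11 closed hs, rule halmos_algebra.ex_meet[OF L])
        (simp_all add: 11 hs)
  next
    case (12 X)
    show ?case
      unfolding hle_def
      by (rule sep[of X], (simp_all add: 12 closed)[3], simp add: 12 closed hs, rule halmos_algebra.ex_comm[OF L])
        (simp_all add: 12 hs)
  next
    case (13 X)
    show ?case
      unfolding hle_def
      by (rule sep[of X], (simp_all add: 13 closed)[3], simp add: 13 closed hs, rule halmos_algebra.eq_refl[OF L])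
        (simp_all add: 13 hs)
  next
    case (14 X ws f ws')
    note pw = wf_ops[OF 14(2) 14(4)] wf_ops[OF 14(3) 14(5)]
    have fold: "foldr (hmeet K X) (map2 (heq K X) ws ws') (hone K X) \<in> hcar K X \<and>
      (\<forall>i\<in>S. \<phi> i X (foldr (hmeet K X) (map2 (heq K X) ws ws') (hone K X))
        = foldr (hmeet (L i) X) (map2 (heq (L i) X) ws ws') (hone (L i) X))"
    proof -
      have "length ws = length ws'" using 14(2,3) by simp
      then show ?thesis
        using 14(4,5) by (induction ws ws' rule: list_induct2) (simp_all add: hs closed 14(1))
    qed
    show ?case
      unfolding hle_def
      by (rule sep[of X], (simp_all add: 14(1) fold pw closed)[3], simp add: 14(1) fold pw hs closed,
          rule halmos_algebra.eq_ops[OF L, unfolded hle_def]) (simp_all add: 14)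
  next
    case (15 X Y)
    show ?case
      unfolding hle_def
      by (rule sep[of Y], (simp_all add: 15 closed)[3], simp add: 15 closed hs, rule halmos_algebra.sub_meet[OF L])
        (simp_all add: 15 hs)
  next
    case (16 X Y)
    show ?case
      unfolding hle_def
      by (rule sep[of Y], (simp_all add: 16 closed)[3], simp add: 16 closed hs, rule halmos_algebra.sub_join[OF L])
        (simp_all add: 16 hs)
  next
    case (17 X Y)
    show ?case
      unfolding hle_def
      by (rule sep[of Y], (simp_all add: 17 closed)[3], simp add: 17 closed hs, rule halmos_algebra.sub_neg[OF L])
        (simp_all add: 17 hs)
  next
    case (18 X Y)
    show ?case
      unfolding hle_def
      by (rule sep[of Y], (simp_all add: 18 closed)[3], simp add: 18 closed hs, rule halmos_algebra.sub_zero[OF L])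
        (simp_all add: 18 hs)
  next
    case (19 X Y)
    show ?case
      unfolding hle_def
      by (rule sep[of Y], (simp_all add: 19 closed)[3], simp add: 19 closed hs, rule halmos_algebra.sub_one[OF L])
        (simp_all add: 19 hs)
  next
    case (20 X)
    show ?case
      unfolding hle_def
      by (rule sep[of X], (simp_all add: 20 closed idW)[3], simp add: 20 closed hs idW, rule halmos_algebra.sub_id[OF L])
        (simp_all add: 20 hs idW)
  next
    case (21 X Y Z)
    show ?case
      unfolding hle_def
      by (rule sep[of Z], (simp_all add: 21 closed comp[OF 21(4,5)])[3], simp add: 21 closed hs comp[OF 21(4,5)], rule halmos_algebra.sub_comp[OF L])
        (simp_all add: 21 hs comp[OF 21(4,5)])
  next
    case (22 X Y)
    show ?case
      unfolding hle_def
      by (rule sep[of Y], (simp_all add: 22 closed)[3], simp add: 22 closed hs, rule halmos_algebra.sub_ex_eq[OF L])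
        (simp_all add: 22 hs)
  next
    case (23 X Y)
    show ?case
      unfolding hle_def
      by (rule sep[of Y], (simp_all add: 23 closed)[3], simp add: 23 closed hs, rule halmos_algebra.sub_ex[OF L])
        (simp_all add: 23 hs)
  next
    case (24 X Y)
    show ?case
      unfolding hle_def
      by (rule sep[of Y], (simp_all add: 24 closed gen_in_W Hom_in[OF 24(3)] idW)[3], simp add: 24 closed hs gen_in_W Hom_in[OF 24(3)] idW, rule halmos_algebra.sub_eq[OF L])
        (simp_all add: 24 hs gen_in_W Hom_in[OF 24(3)] idW)
  next
    case (25 X)
    show ?case
      unfolding hle_def
      by (rule sep[of X], (simp_all add: 25 closed gen_in_W Hom_in[OF 25(3)] Hom_in[OF 25(4)] idW)[3], simp add: 25 closed hs gen_in_W Hom_in[OF 25(3)] Hom_in[OF 25(4)] idW, rule halmos_algebra.eq_sub[OF L, unfolded hle_def])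
        (simp_all add: 25 hs gen_in_W Hom_in[OF 25(3)] Hom_in[OF 25(4)] idW)
  qed
qed

primrec ev :: "('f, 'x, 'l) hal \<Rightarrow> ('f, 'x) fm \<Rightarrow> 'l" where
  "ev L (FMeet X u v) = hmeet L X (ev L u) (ev L v)"
| "ev L (FJoin X u v) = hjoin L X (ev L u) (ev L v)"
| "ev L (FNeg X u) = hneg L X (ev L u)"
| "ev L (FZero X) = hzero L X"
| "ev L (FOne X) = hone L X"
| "ev L (FEx X x u) = hex L X x (ev L u)"
| "ev L (FEq X w w') = heq L X w w'"
| "ev L (FSub X Y s u) = hsub L X Y s (ev L u)"

lemma is_fm_Sorts: "is_fm \<Theta> X0 X u \<Longrightarrow> X \<in> Sorts X0"
  by (induction rule: is_fm.induct) auto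

lemma Fm_structure: "hal_structure \<Theta> X0 (Fm \<Theta> X0)"
  by unfold_locales (auto simp: Fm_def intro: is_fm.intros)

lemma ev_hom:
  assumes "hal_structure \<Theta> X0 L"
  shows "(\<lambda>X\<in>Sorts X0. \<lambda>u\<in>hcar (Fm \<Theta> X0) X. ev L u) \<in> hal_hom \<Theta> X0 (Fm \<Theta> X0) L"
proof -
  interpret L: hal_structure \<Theta> X0 L by fact
  interpret F: hal_structure \<Theta> X0 "Fm \<Theta> X0" by (rule Fm_structure)
  have "ev L u \<in> hcar L X" if "is_fm \<Theta> X0 X u" for X u
    using that
    by induction (simp_all add: is_fm_Sorts L.meet_closed L.join_closed L.neg_closed
        L.zero_closed L.one_closed L.ex_closed L.eq_closed L.sub_closed)
  then show ?thesis
    by (intro F.hal_homI) (simp_all add: Fm_def)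
qed

lemma Fm_hom_unique:
  assumes h: "h \<in> hal_hom \<Theta> X0 (Fm \<Theta> X0) L" and k: "k \<in> hal_hom \<Theta> X0 (Fm \<Theta> X0) L"
    and "is_fm \<Theta> X0 X u"
  shows "h X u = k X u"
  using assms(3)
  by induction (use hal_homD[OF h] hal_homD[OF k] in \<open>simp_all add: Fm_def is_fm_Sorts\<close>)

lemma total_halmos_cong:
  assumes "is_variety \<Theta>"
  shows "\<exists>\<theta>. hal_cong \<Theta> X0 (Fm \<Theta> X0) \<theta> \<and> halmos_algebra \<Theta> X0 (hal_quot (Fm \<Theta> X0) \<theta>)"
proof -
  interpret F: hal_structure \<Theta> X0 "Fm \<Theta> X0" by (rule Fm_structure)
  let ?\<theta> = "\<lambda>X. hcar (Fm \<Theta> X0) X \<times> hcar (Fm \<Theta> X0) X"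
  have "equiv A (A \<times> A)" for A :: "'c set"
    by (rule equivI) (auto intro!: refl_onI symI transI)
  then have \<theta>: "hal_cong \<Theta> X0 (Fm \<Theta> X0) ?\<theta>"
    unfolding hal_cong_def
    by (auto simp: F.meet_closed F.join_closed F.neg_closed F.ex_closed F.sub_closed)
  moreover have "halmos_algebra \<Theta> X0 (hal_quot (Fm \<Theta> X0) ?\<theta>)"
    by (rule halmos_algebra_separated[OF assms hal_quot_structure[OF Fm_structure \<theta>],
          where S = "{} :: unit set" and L = "\<lambda>_. undefined" and \<phi> = "\<lambda>_. undefined"])
      (auto elim!: hal_quot_carE)
  ultimately show ?thesis by blast
qed

lemma halmos_cong_hal_cong:
  assumes "is_variety \<Theta>"
  shows "hal_cong \<Theta> X0 (Fm \<Theta> X0) (halmos_cong \<Theta> X0)"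
proof -
  define C where "C = {\<theta>. hal_cong \<Theta> X0 (Fm \<Theta> X0) \<theta> \<and>
    halmos_algebra \<Theta> X0 (hal_quot (Fm \<Theta> X0) \<theta>)}"
  have ne: "C \<noteq> {}" using total_halmos_cong[OF assms] by (auto simp: C_def)
  have C: "hal_cong \<Theta> X0 (Fm \<Theta> X0) \<theta>" if "\<theta> \<in> C" for \<theta> using that by (simp add: C_def)
  have iff: "p \<in> halmos_cong \<Theta> X0 X \<longleftrightarrow> (\<forall>\<theta>\<in>C. p \<in> \<theta> X)" for p X
    by (auto simp: halmos_cong_def C_def)
  have "equiv (hcar (Fm \<Theta> X0) X) (halmos_cong \<Theta> X0 X)" if X: "X \<in> Sorts X0" for X
  proof (rule equivI)
    note e = hal_congD(1)[OF C X]
    show "halmos_cong \<Theta> X0 X \<subseteq> hcar (Fm \<Theta> X0) X \<times> hcar (Fm \<Theta> X0) X"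
    proof
      fix p assume "p \<in> halmos_cong \<Theta> X0 X"
      moreover obtain \<theta> where "\<theta> \<in> C" using ne by auto
      ultimately show "p \<in> hcar (Fm \<Theta> X0) X \<times> hcar (Fm \<Theta> X0) X"
        using equiv_type[OF e] iff by blast
    qed
    show "refl_on (hcar (Fm \<Theta> X0) X) (halmos_cong \<Theta> X0 X)"
      by (rule refl_onI) (use e in \<open>auto simp: iff dest: equivE refl_onD\<close>)
    show "sym (halmos_cong \<Theta> X0 X)"
      by (rule symI) (use e in \<open>meson iff equivE symE\<close>)
    show "trans (halmos_cong \<Theta> X0 X)"
      by (rule transI) (use e in \<open>meson iff equivE transE\<close>)
  qed
  then show ?thesis
    unfolding hal_cong_def by (auto simp: iff intro!: hal_congD(2-6)[OF C])
qed

theorem Phi_halmos_algebra: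
  assumes "is_variety \<Theta>"
  shows "halmos_algebra \<Theta> X0 (\<Phi> \<Theta> X0)"
proof -
  let ?F = "Fm \<Theta> X0"
  define C where "C = {\<theta>. hal_cong \<Theta> X0 ?F \<theta> \<and> halmos_algebra \<Theta> X0 (hal_quot ?F \<theta>)}"
  have C: "hal_cong \<Theta> X0 ?F \<theta>" "halmos_algebra \<Theta> X0 (hal_quot ?F \<theta>)" if "\<theta> \<in> C" for \<theta>
    using that by (simp_all add: C_def)
  have iff: "p \<in> halmos_cong \<Theta> X0 X \<longleftrightarrow> (\<forall>\<theta>\<in>C. p \<in> \<theta> X)" for p X
    by (auto simp: halmos_cong_def C_def)
  note cong = halmos_cong_hal_cong[OF assms]
  have "\<exists>g\<in>hal_hom \<Theta> X0 (\<Phi> \<Theta> X0) (hal_quot ?F \<theta>). \<forall>X\<in>Sorts X0. \<forall>a\<in>hcar ?F X.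
      g X (halmos_cong \<Theta> X0 X `` {a}) = \<theta> X `` {a}" if \<theta>C: "\<theta> \<in> C" for \<theta>
  proof -
    note \<theta> = C(1)[OF \<theta>C]
    have "(\<lambda>X\<in>Sorts X0. \<lambda>a\<in>hcar ?F X. \<theta> X `` {a}) X a
        = (\<lambda>X\<in>Sorts X0. \<lambda>a\<in>hcar ?F X. \<theta> X `` {a}) X b"
      if X: "X \<in> Sorts X0" and ab: "(a, b) \<in> halmos_cong \<Theta> X0 X" for X a b
    proof -
      have "(a, b) \<in> \<theta> X" using ab \<theta>C by (simp add: iff)
      then have "\<theta> X `` {a} = \<theta> X `` {b}" "a \<in> hcar ?F X" "b \<in> hcar ?F X"
        using equiv_class_eq[OF hal_congD(1)[OF \<theta> X]] equiv_type[OF hal_congD(1)[OF \<theta> X]]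
        by auto
      then show ?thesis using X by simp
    qed
    from hal_quot_factor[OF Fm_structure cong hal_quot_canonical[OF Fm_structure \<theta>] this]
    show ?thesis by (simp add: \<Phi>_def)
  qed
  then have "\<forall>\<theta>\<in>C. \<exists>g. g \<in> hal_hom \<Theta> X0 (\<Phi> \<Theta> X0) (hal_quot ?F \<theta>) \<and>
      (\<forall>X\<in>Sorts X0. \<forall>a\<in>hcar ?F X. g X (halmos_cong \<Theta> X0 X `` {a}) = \<theta> X `` {a})"
    by (simp add: Bex_def)
  from bchoice[OF this] obtain g where
    "\<forall>\<theta>\<in>C. g \<theta> \<in> hal_hom \<Theta> X0 (\<Phi> \<Theta> X0) (hal_quot ?F \<theta>) \<and>
      (\<forall>X\<in>Sorts X0. \<forall>a\<in>hcar ?F X. g \<theta> X (halmos_cong \<Theta> X0 X `` {a}) = \<theta> X `` {a})" ..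
  then have g: "\<And>\<theta>. \<theta> \<in> C \<Longrightarrow> g \<theta> \<in> hal_hom \<Theta> X0 (\<Phi> \<Theta> X0) (hal_quot ?F \<theta>)"
    "\<And>\<theta> X a. \<theta> \<in> C \<Longrightarrow> X \<in> Sorts X0 \<Longrightarrow> a \<in> hcar ?F X \<Longrightarrow>
      g \<theta> X (halmos_cong \<Theta> X0 X `` {a}) = \<theta> X `` {a}"
    by simp_all
  show ?thesis
  proof (rule halmos_algebra_separated[OF assms, where S = C and L = "hal_quot ?F" and \<phi> = g])
    show "hal_structure \<Theta> X0 (\<Phi> \<Theta> X0)"
      unfolding \<Phi>_def by (rule hal_quot_structure[OF Fm_structure cong])
    show "halmos_algebra \<Theta> X0 (hal_quot ?F \<theta>)" if "\<theta> \<in> C" for \<theta> by (rule C(2)[OF that])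
    show "g \<theta> \<in> hal_hom \<Theta> X0 (\<Phi> \<Theta> X0) (hal_quot ?F \<theta>)" if "\<theta> \<in> C" for \<theta>
      by (rule g(1)[OF that])
    fix X A B
    assume X: "X \<in> Sorts X0" and AB: "A \<in> hcar (\<Phi> \<Theta> X0) X" "B \<in> hcar (\<Phi> \<Theta> X0) X"
      and eq: "\<And>\<theta>. \<theta> \<in> C \<Longrightarrow> g \<theta> X A = g \<theta> X B"
    obtain a where a: "a \<in> hcar ?F X" "A = halmos_cong \<Theta> X0 X `` {a}"
      using AB(1) unfolding \<Phi>_def by (rule hal_quot_carE)
    obtain b where b: "b \<in> hcar ?F X" "B = halmos_cong \<Theta> X0 X `` {b}"
      using AB(2) unfolding \<Phi>_def by (rule hal_quot_carE)
    note ab = a b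
    have "(a, b) \<in> \<theta> X" if "\<theta> \<in> C" for \<theta>
    proof -
      have "\<theta> X `` {a} = \<theta> X `` {b}"
        using eq[OF that] g(2)[OF that X] ab by simp
      then show ?thesis
        by (rule eq_equiv_class[OF _ hal_congD(1)[OF C(1)[OF that] X] b(1)])
    qed
    then have "(a, b) \<in> halmos_cong \<Theta> X0 X"
      by (simp add: iff)
    then show "A = B"
      using ab equiv_class_eq[OF hal_congD(1)[OF cong X]] by simp
  qed
qed

text \<open>A homomorphism preserves the constants \<open>heq\<close>, so it sends each formal equality to the
  corresponding equality of the target.\<close>

theorem Phi_free:
  assumes \<Theta>: "is_variety \<Theta>" and L: "halmos_algebra \<Theta> X0 L"
  shows "\<exists>!\<phi>. \<phi> \<in> hal_hom \<Theta> X0 (\<Phi> \<Theta> X0) L"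
proof (rule ex_ex1I)
  let ?F = "Fm \<Theta> X0"
  note cong = halmos_cong_hal_cong[OF \<Theta>]
  interpret L: halmos_algebra \<Theta> X0 L by (rule L)
  define h where "h = (\<lambda>X\<in>Sorts X0. \<lambda>u\<in>hcar ?F X. ev L u)"
  have h: "h \<in> hal_hom \<Theta> X0 ?F L"
    unfolding h_def by (rule ev_hom) unfold_locales
  define \<theta> where "\<theta> = (\<lambda>X. {(a, b). a \<in> hcar ?F X \<and> b \<in> hcar ?F X \<and> h X a = h X b})"
  have \<theta>: "hal_cong \<Theta> X0 ?F \<theta>"
    unfolding \<theta>_def by (rule hal_hom_kernel[OF Fm_structure h])
  obtain g where g: "g \<in> hal_hom \<Theta> X0 (hal_quot ?F \<theta>) L"
    "\<forall>X\<in>Sorts X0. \<forall>a\<in>hcar ?F X. g X (\<theta> X `` {a}) = h X a"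
    using hal_quot_factor[OF Fm_structure \<theta> h] by (auto simp: \<theta>_def)
  have "halmos_algebra \<Theta> X0 (hal_quot ?F \<theta>)"
  proof (rule halmos_algebra_separated[OF \<Theta>, where S = "{()}" and L = "\<lambda>_. L" and \<phi> = "\<lambda>_. g"])
    show "hal_structure \<Theta> X0 (hal_quot ?F \<theta>)" by (rule hal_quot_structure[OF Fm_structure \<theta>])
    fix X A B
    assume X: "X \<in> Sorts X0" and AB: "A \<in> hcar (hal_quot ?F \<theta>) X" "B \<in> hcar (hal_quot ?F \<theta>) X"
      and eq: "\<And>i. i \<in> {()} \<Longrightarrow> g X A = g X B"
    obtain a where a: "a \<in> hcar ?F X" "A = \<theta> X `` {a}"
      using AB(1) by (rule hal_quot_carE)
    obtain b where b: "b \<in> hcar ?F X" "B = \<theta> X `` {b}"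
      using AB(2) by (rule hal_quot_carE)
    note ab = a b
    then have "(a, b) \<in> \<theta> X" using eq g(2) X by (simp add: \<theta>_def)
    then show "A = B" using ab equiv_class_eq[OF hal_congD(1)[OF \<theta> X]] by simp
  qed (use L g in simp_all)
  then have sub: "halmos_cong \<Theta> X0 X \<subseteq> \<theta> X" for X
    using \<theta> by (auto simp: halmos_cong_def)
  have "\<exists>g\<in>hal_hom \<Theta> X0 (hal_quot ?F (halmos_cong \<Theta> X0)) L.
      \<forall>X\<in>Sorts X0. \<forall>a\<in>hcar ?F X. g X (halmos_cong \<Theta> X0 X `` {a}) = h X a"
  proof (rule hal_quot_factor[OF Fm_structure cong h])
    fix X a b assume "(a, b) \<in> halmos_cong \<Theta> X0 X"
    then have "(a, b) \<in> \<theta> X" using sub by blast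
    then show "h X a = h X b" by (simp add: \<theta>_def)
  qed
  then show "\<exists>\<phi>. \<phi> \<in> hal_hom \<Theta> X0 (\<Phi> \<Theta> X0) L"
    unfolding \<Phi>_def by blast
next
  let ?F = "Fm \<Theta> X0"
  fix \<phi> \<psi> assume *: "\<phi> \<in> hal_hom \<Theta> X0 (\<Phi> \<Theta> X0) L" "\<psi> \<in> hal_hom \<Theta> X0 (\<Phi> \<Theta> X0) L"
  note cong = halmos_cong_hal_cong[OF \<Theta>]
  interpret F: hal_structure \<Theta> X0 ?F by (rule Fm_structure)
  have hom: "(\<lambda>X\<in>Sorts X0. \<lambda>u\<in>hcar ?F X. \<chi> X (halmos_cong \<Theta> X0 X `` {u})) \<in> hal_hom \<Theta> X0 ?F L"
    if "\<chi> \<in> hal_hom \<Theta> X0 (\<Phi> \<Theta> X0) L" for \<chi>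
  proof -
    note d = hal_homD[OF that, unfolded \<Phi>_def]
    show ?thesis
      by (rule F.hal_homI)
        (use d in \<open>simp_all add: hal_quot_carI quot_simps[OF cong, symmetric]
          hal_quot_consts[symmetric]\<close>)
  qed
  have ext: "\<chi> \<in> extensional (Sorts X0)" "X \<in> Sorts X0 \<Longrightarrow> \<chi> X \<in> extensional (hcar (\<Phi> \<Theta> X0) X)"
    if "\<chi> \<in> hal_hom \<Theta> X0 (\<Phi> \<Theta> X0) L" for \<chi> X
    using that by (auto simp: hal_hom_def PiE_def Pi_def)
  show "\<phi> = \<psi>"
  proof (rule extensionalityI[OF ext(1)[OF *(1)] ext(1)[OF *(2)]])
    fix X assume X: "X \<in> Sorts X0"
    show "\<phi> X = \<psi> X"
    proof (rule extensionalityI[OF ext(2)[OF *(1) X] ext(2)[OF *(2) X]])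
      fix A assume "A \<in> hcar (\<Phi> \<Theta> X0) X"
      then obtain u where u: "u \<in> hcar ?F X" "A = halmos_cong \<Theta> X0 X `` {u}"
        unfolding \<Phi>_def by (rule hal_quot_carE)
      then have "is_fm \<Theta> X0 X u" by (simp add: Fm_def)
      from Fm_hom_unique[OF hom[OF *(1)] hom[OF *(2)] this]
      show "\<phi> X A = \<psi> X A" using u X by simp
    qed
  qed
qed

corollary Val_hom:
  assumes "is_variety \<Theta>" and "in_variety \<Theta> H"
  shows "Val \<Theta> X0 H \<in> hal_hom \<Theta> X0 (\<Phi> \<Theta> X0) (Hal \<Theta> H)"
  unfolding Val_def by (rule theI'[OF Phi_free[OF assms(1) Hal_halmos_algebra[OF assms]]])

end

(* Logically equivalent algebras realize the same complete types. The type of the generators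
   of W(X) is therefore realized in H' by a homomorphism nu: W(X) -> H', which is injective because
   equalities are formulas. For surjectivity, extend nu to one further variable y by a point a of H',
   and realize the type of the extension by mu in W(X). The restriction of mu to W(X) has
   the type of the generators, so by homogeneity it is an automorphism; hence mu identifies y with
   some word w over X, and therefore a = nu(w). *)
theory Submission
  imports Defs
begin

text \<open>The main argument builds a bijective homomorphism out of \<open>W \<Theta> X\<close>,
  while separability asks for one into it.\<close>

lemma isomorphicI_sym:
  assumes A: "in_variety \<Theta> A" and h: "h \<in> Hom \<Theta> A B" and bij: "bij_betw h (univ A) (univ B)"
  shows "isomorphic \<Theta> B A"
proof -
  \<comment> \<open>The restriction is needed because members of \<open>Hom\<close> are
    extensional.\<close>
  define k where "k = restrict (inv_into (univ A) h) (univ B)"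
  have kin: "k b \<in> univ A" and hk: "h (k b) = b" if "b \<in> univ B" for b
    using that bij_betw_imp_surj_on[OF bij]
    by (auto simp: k_def inv_into_into f_inv_into_f)
  have "k (ops B f bs) = ops A f (map k bs)"
    if bs: "length bs = arity \<Theta> f" "set bs \<subseteq> univ B" for f bs
  proof -
    have as: "length (map k bs) = arity \<Theta> f" "set (map k bs) \<subseteq> univ A"
      using bs kin by auto
    have "map h (map k bs) = bs"
      using bs(2) hk by (auto intro!: map_idI)
    then have "h (ops A f (map k bs)) = ops B f bs"
      using h as unfolding Hom_def by force
    moreover have "ops A f (map k bs) \<in> univ A"
      using A as unfolding in_variety_def by blast
    ultimately show ?thesis
      using bij Hom_in[OF h] by (metis bij_betw_def inv_into_f_f k_def restrict_apply')
  qed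
  then have "k \<in> Hom \<Theta> B A"
    using kin by (auto simp: Hom_def k_def)
  moreover have "bij_betw k (univ B) (univ A)"
    unfolding k_def bij_betw_restrict_eq by (rule bij_betw_inv_into[OF bij])
  ultimately show ?thesis
    by (auto simp: isomorphic_def)
qed

context
  fixes \<Theta> :: "'f variety" and X0 :: "'x set" and H :: "('f, 'h) algebra"
  assumes \<Theta>: "is_variety \<Theta>" and H: "in_variety \<Theta> H"
begin

interpretation P: halmos_algebra \<Theta> X0 "\<Phi> \<Theta> X0"
  by (rule Phi_halmos_algebra[OF \<Theta>])

lemmas Val_simps = hal_homD[OF Val_hom[OF \<Theta> H, of X0]]

lemma LKer_neg_iff:
  assumes "X \<in> Sorts X0" "\<mu> \<in> Hom \<Theta> (W \<Theta> X) H" "u \<in> hcar (\<Phi> \<Theta> X0) X"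
  shows "hneg (\<Phi> \<Theta> X0) X u \<in> LKer \<Theta> X0 H X \<mu> \<longleftrightarrow> u \<notin> LKer \<Theta> X0 H X \<mu>"
  using assms P.neg_closed by (simp add: LKer_def Val_simps) (simp add: Hal_def)

lemma LKer_eq_iff:
  assumes "X \<in> Sorts X0" "\<mu> \<in> Hom \<Theta> (W \<Theta> X) H" "w \<in> univ (W \<Theta> X)" "w' \<in> univ (W \<Theta> X)"
  shows "heq (\<Phi> \<Theta> X0) X w w' \<in> LKer \<Theta> X0 H X \<mu> \<longleftrightarrow> \<mu> w = \<mu> w'"
  using assms P.eq_closed by (simp add: LKer_def Val_simps) (simp add: Hal_def)

text \<open>Through this, the kernel of a point determines the kernels of its restrictions to other
  sorts.\<close>

lemma LKer_sub_iff:
  assumes "X \<in> Sorts X0" "Y \<in> Sorts X0" "s \<in> Hom \<Theta> (W \<Theta> X) (W \<Theta> Y)"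
    "\<mu> \<in> Hom \<Theta> (W \<Theta> Y) H" "u \<in> hcar (\<Phi> \<Theta> X0) X"
  shows "hsub (\<Phi> \<Theta> X0) X Y s u \<in> LKer \<Theta> X0 H Y \<mu> \<longleftrightarrow>
    u \<in> LKer \<Theta> X0 H X (compose (univ (W \<Theta> X)) \<mu> s)"
  using assms P.sub_closed by (simp add: LKer_def Val_simps) (simp add: Hal_def)

end

text \<open>A kernel contains exactly one of \<open>u\<close> and its negation, so kernels are
  maximal: a formula gained on the right would have its negation on the left, hence also on the
  right.\<close>

lemma LKer_subset_imp_eq:
  assumes "is_variety \<Theta>" "in_variety \<Theta> H" "in_variety \<Theta> K" "X \<in> Sorts X0"
    and "\<mu> \<in> Hom \<Theta> (W \<Theta> X) H" "\<nu> \<in> Hom \<Theta> (W \<Theta> X) K"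
    and sub: "LKer \<Theta> X0 H X \<mu> \<subseteq> LKer \<Theta> X0 K X \<nu>"
  shows "LKer \<Theta> X0 H X \<mu> = LKer \<Theta> X0 K X \<nu>"
proof (rule ccontr)
  assume "LKer \<Theta> X0 H X \<mu> \<noteq> LKer \<Theta> X0 K X \<nu>"
  then obtain u where u: "u \<in> LKer \<Theta> X0 K X \<nu>" "u \<notin> LKer \<Theta> X0 H X \<mu>"
    using sub by blast
  have "u \<in> hcar (\<Phi> \<Theta> X0) X" using u(1) by (simp add: LKer_def)
  then show False
    using u sub LKer_neg_iff[of \<Theta> H X X0 \<mu> u] LKer_neg_iff[of \<Theta> K X X0 \<nu> u] assms by blast
qed

lemma LG_equivalent_sym: "LG_equivalent \<Theta> X0 H K \<Longrightarrow> LG_equivalent \<Theta> X0 K H"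
  by (simp add: LG_equivalent_def)

text \<open>If no point of \<open>K\<close> satisfied all of \<open>T = LKer(\<mu>)\<close>, the
  closure of \<open>T\<close> over \<open>K\<close> would be all formulas of sort \<open>X\<close>.
  Over \<open>H\<close> the closure stays inside \<open>T\<close>, which is proper. A point of
  \<open>K\<close> satisfying \<open>T\<close> then has kernel exactly \<open>T\<close> by
  maximality.\<close>

lemma LG_equivalent_realizes:
  assumes \<Theta>: "is_variety \<Theta>" and H: "in_variety \<Theta> H" and K: "in_variety \<Theta> K"
    and eq: "LG_equivalent \<Theta> X0 H K" and X: "X \<in> Sorts X0"
    and \<mu>: "\<mu> \<in> Hom \<Theta> (W \<Theta> X) H"
  obtains \<nu> where "\<nu> \<in> Hom \<Theta> (W \<Theta> X) K" "LKer \<Theta> X0 K X \<nu> = LKer \<Theta> X0 H X \<mu>"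
proof -
  interpret P: halmos_algebra \<Theta> X0 "\<Phi> \<Theta> X0"
    by (rule Phi_halmos_algebra[OF \<Theta>])
  let ?T = "LKer \<Theta> X0 H X \<mu>"
  have "?T \<subseteq> hcar (\<Phi> \<Theta> X0) X"
    by (auto simp: LKer_def)
  then have "pt_L \<Theta> X0 H X (fm_L \<Theta> X0 H X ?T) = pt_L \<Theta> X0 K X (fm_L \<Theta> X0 K X ?T)"
    using eq X by (simp add: LG_equivalent_def)
  moreover have "pt_L \<Theta> X0 H X (fm_L \<Theta> X0 H X ?T) \<subseteq> ?T"
    using \<mu> by (auto simp: pt_L_def fm_L_def)
  \<comment> \<open>Either zero or its negation lies outside \<open>?T\<close>.\<close>
  moreover have "\<exists>u\<in>hcar (\<Phi> \<Theta> X0) X. u \<notin> ?T"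
    using LKer_neg_iff[OF \<Theta> H X \<mu> P.zero_closed[OF X]] P.zero_closed[OF X] P.neg_closed[OF X]
    by blast
  ultimately have "fm_L \<Theta> X0 K X ?T \<noteq> {}"
    by (auto simp: pt_L_def)
  then obtain \<nu> where "\<nu> \<in> Hom \<Theta> (W \<Theta> X) K" "?T \<subseteq> LKer \<Theta> X0 K X \<nu>"
    by (auto simp: fm_L_def)
  then show thesis
    using that LKer_subset_imp_eq[OF \<Theta> H K X \<mu>] by blast
qed

lemma logically_homogeneous_W_imp_separable:
  fixes \<Theta> :: "'f variety" and X0 :: "'x set"
  assumes \<Theta>: "is_variety \<Theta>" and inf: "infinite X0" and X: "X \<in> Sorts X0"
    and hom: "logically_homogeneous \<Theta> X0 (W \<Theta> X)"
  shows "logically_separable TYPE('b) \<Theta> X0 (W \<Theta> X)"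
  unfolding logically_separable_def
proof (intro allI impI)
  fix H :: "('f, 'b) algebra"
  assume H: "in_variety \<Theta> H" and eq: "LG_equivalent \<Theta> X0 H (W \<Theta> X)"
  note WW = W_in_variety[OF \<Theta>, where 'b = 'x]
  \<comment> \<open>The point of \<open>W \<Theta> X\<close> that sends each generator to
    itself.\<close>
  let ?id = "restrict id (univ (W \<Theta> X))"
  have id: "?id \<in> Hom \<Theta> (W \<Theta> X) (W \<Theta> X)"
    using W_closed[OF \<Theta>] by (auto simp: Hom_def intro!: arg_cong[where f = "ops _ _"] map_idI[symmetric])
  obtain \<nu> where \<nu>: "\<nu> \<in> Hom \<Theta> (W \<Theta> X) H"
    and \<nu>_id: "LKer \<Theta> X0 H X \<nu> = LKer \<Theta> X0 (W \<Theta> X) X ?id"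
    using LG_equivalent_realizes[OF \<Theta> WW H LG_equivalent_sym[OF eq] X id] .
  have "inj_on \<nu> (univ (W \<Theta> X))"
  proof (rule inj_onI)
    fix w w' assume w: "w \<in> univ (W \<Theta> X)" "w' \<in> univ (W \<Theta> X)" and "\<nu> w = \<nu> w'"
    then show "w = w'"
      using LKer_eq_iff[OF \<Theta> H X \<nu> w] LKer_eq_iff[OF \<Theta> WW X id w] \<nu>_id by simp
  qed
  moreover have "\<exists>w\<in>univ (W \<Theta> X). a = \<nu> w" if a: "a \<in> univ H" for a
  proof -
    \<comment> \<open>A fresh variable exists since \<open>X\<close> is finite and \<open>X0\<close>
      infinite.\<close>
    obtain y where y: "y \<in> X0" "y \<notin> X"
      using inf X by (auto simp: Sorts_def dest: rev_finite_subset)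
    let ?Y = "insert y X"
    have Y: "?Y \<in> Sorts X0" using X y by (simp add: Sorts_def)
    \<comment> \<open>Composing a point of sort \<open>?Y\<close> with \<open>i\<close> restricts it
      to the variables in \<open>X\<close>.\<close>
    obtain i where i: "i \<in> Hom \<Theta> (W \<Theta> X) (W \<Theta> ?Y)" "\<forall>x\<in>X. i (gen \<Theta> X x) = gen \<Theta> ?Y x"
      using Hom_W_ex[OF \<Theta> WW, of X "gen \<Theta> ?Y" ?Y] gen_in_W[of _ ?Y \<Theta>] by auto
    define v where "v = (\<lambda>x. if x = y then a else \<nu> (gen \<Theta> X x))"
    have "v x \<in> univ H" if "x \<in> ?Y" for x
      using that a Hom_in[OF \<nu> gen_in_W] by (auto simp: v_def)
    then obtain \<nu>' where \<nu>': "\<nu>' \<in> Hom \<Theta> (W \<Theta> ?Y) H" "\<forall>x\<in>?Y. \<nu>' (gen \<Theta> ?Y x) = v x"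
      using Hom_W_ex[OF \<Theta> H, of ?Y v] by blast
    have \<nu>'i: "compose (univ (W \<Theta> X)) \<nu>' i = \<nu>"
      by (rule Hom_W_eqI[OF \<Theta> H Hom_compose[OF WW i(1) \<nu>'(1)] \<nu>])
        (use i(2) \<nu>'(2) y in \<open>auto simp: v_def compose_eq gen_in_W\<close>)
    obtain \<mu> where \<mu>: "\<mu> \<in> Hom \<Theta> (W \<Theta> ?Y) (W \<Theta> X)"
      and \<mu>_\<nu>': "LKer \<Theta> X0 (W \<Theta> X) ?Y \<mu> = LKer \<Theta> X0 H ?Y \<nu>'"
      using LG_equivalent_realizes[OF \<Theta> H WW eq Y \<nu>'(1)] .
    let ?\<mu>i = "compose (univ (W \<Theta> X)) \<mu> i"
    \<comment> \<open>Both sides say that the translate of \<open>u\<close> along \<open>i\<close>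
      holds, at \<open>\<mu>\<close> and at \<open>\<nu>'\<close> respectively, and these two points
      have the same kernel.\<close>
    have "u \<in> LKer \<Theta> X0 (W \<Theta> X) X ?\<mu>i \<longleftrightarrow> u \<in> LKer \<Theta> X0 H X \<nu>"
      if "u \<in> hcar (\<Phi> \<Theta> X0) X" for u
      using LKer_sub_iff[OF \<Theta> WW X Y i(1) \<mu> that] LKer_sub_iff[OF \<Theta> H X Y i(1) \<nu>'(1) that]
        \<mu>_\<nu>' \<nu>'i by simp
    then have "LKer \<Theta> X0 (W \<Theta> X) X ?\<mu>i = LKer \<Theta> X0 (W \<Theta> X) X ?id"
      unfolding \<nu>_id[symmetric] by (auto simp: LKer_def)
    then obtain \<sigma> where \<sigma>: "\<sigma> \<in> Aut \<Theta> (W \<Theta> X)" "?\<mu>i = compose (univ (W \<Theta> X)) \<sigma> ?id"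
      using hom X id Hom_compose[OF WW i(1) \<mu>] unfolding logically_homogeneous_def by blast
    have gy: "gen \<Theta> ?Y y \<in> univ (W \<Theta> ?Y)" by (simp add: gen_in_W)
    \<comment> \<open>Surjectivity of \<open>\<sigma>\<close> supplies the preimage
      \<open>w\<close>; as \<open>\<sigma>\<close> agrees with \<open>\<mu>\<close> after
      \<open>i\<close>, the value of \<open>\<mu>\<close> at \<open>y\<close> is its value at
      \<open>i w\<close>.\<close>
    have "\<mu> (gen \<Theta> ?Y y) \<in> \<sigma> ` univ (W \<Theta> X)"
      using Hom_in[OF \<mu> gy] \<sigma>(1) by (simp add: Aut_def bij_betw_def)
    then obtain w where w: "w \<in> univ (W \<Theta> X)" "\<mu> (gen \<Theta> ?Y y) = \<sigma> w" by auto
    then have "\<mu> (gen \<Theta> ?Y y) = \<mu> (i w)"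
      using fun_cong[OF \<sigma>(2), of w] by (simp add: compose_eq)
    \<comment> \<open>The formal equality of \<open>y\<close> and \<open>i w\<close> transfers from
      \<open>\<mu>\<close> to \<open>\<nu>'\<close>.\<close>
    then have "\<nu>' (gen \<Theta> ?Y y) = \<nu>' (i w)"
      using LKer_eq_iff[OF \<Theta> WW Y \<mu> gy Hom_in[OF i(1) w(1)]]
        LKer_eq_iff[OF \<Theta> H Y \<nu>'(1) gy Hom_in[OF i(1) w(1)]] \<mu>_\<nu>' by simp
    then have "a = \<nu> w"
      using \<nu>'(2) w(1) by (simp add: v_def \<nu>'i[symmetric] compose_eq)
    then show ?thesis using w(1) by blast
  qed
  ultimately have "bij_betw \<nu> (univ (W \<Theta> X)) (univ H)"
    using Hom_in[OF \<nu>] by (auto simp: bij_betw_def)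
  then show "isomorphic \<Theta> H (W \<Theta> X)"
    by (rule isomorphicI_sym[OF WW \<nu>])
qed

theorem theorem3p30:
  fixes \<Theta> :: "'f variety" and X0 :: "'x set"
  assumes "is_variety \<Theta>" and "infinite X0" and "logically_perfect \<Theta> X0"
  shows "logically_regular TYPE('b) \<Theta> X0"
  using assms logically_homogeneous_W_imp_separable
  unfolding logically_perfect_def logically_regular_def by blast

end
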